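(* Let $K$ be a field of characteristic different from $2$. Every MT grading on $\mathrm{UJ}_n$ (by an arbitrary group) has commutative support. If $G$ is an abelian group, then there is a 1--1 correspondence between the non-isomorphic MT $G$-gradings on $\mathrm{UJ}_n$ (that is, MT $G$-gradings up to isomorphism of $G$-graded algebras) and the set $M$, where 1. if $n$ is odd, $M=\{(t,\eta)\mid t\in G,\ o(t)=2,\ \eta\in (G/\langle t\rangle)^{\frac{n-1}{2}}\}$; 2. if $n$ is even, $M=\{(t,\eta)\mid t\in G,\ o(t)=2,\ \eta\in (G/\langle t\rangle)^{\frac{n-2}{2}}\times G\}$.
   Context: $\mathrm{UJ}_n$ is the $K$-vector space of upper triangular $n\times n$ matrices over $K$ with the Jordan product $a\circ b=ab+ba$. For a group $G$, a $G$-grading on an algebra $A$ with product $\circ$ is a vector space decomposition $A=\bigoplus_{g\in G}A_g$ with $A_g\circ A_h\subseteq A_{gh}$ for all $g,h\in G$; the nonzero elements of $A_g$ are homogeneous of degree $g$ (written $\deg$), and the support is $\{g\in G: A_g\neq 0\}$. The support is commutative if any two of its elements commute in $G$. An isomorphism of $G$-graded algebras is an algebra isomorphism mapping the component of degree $g$ onto the component of degree $g$ for every $g\in G$. $o(t)$ denotes the order of $t$, and $\langle t\rangle$ the subgroup generated by $t$. Let $e_{ij}$ denote the matrix units. For integers $i\ge 1$, $m\ge 0$ with $i+m\le n$ put $e_{i:m}=e_{i,i+m}$, $e_{-i:m}=e_{n-i-m+1,\,n-i+1}$, $Y_{i:m}^+=e_{i:m}+e_{-i:m}$ and $Y_{i:m}^-=e_{i:m}-e_{-i:m}$.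 (If $n-m$ is odd and $i=(n-m+1)/2$, then $Y_{i:m}^+=2e_{i:m}$ and $Y_{i:m}^-=0$.) A $G$-grading on $\mathrm{UJ}_n$ is of mirror type (MT) if all $Y_{i:m}^+$ and $Y_{i:m}^-$ are homogeneous and $\deg Y_{i:m}^+\neq\deg Y_{i:m}^-$, the latter condition being understood for those $(i,m)$ with $Y_{i:m}^-\ne 0$.
   Formalization: Commutative support is claimed for n ≥ 1, n ≠ 2 (it fails for n = 2: I, e11−e22, e12 may have degrees 1, t, g with g not commuting with t); the correspondence is claimed for n ≥ 2 (for n = 1 there is one grading, while M has one element per involution of G). *)

theory Defs
  imports
    "HOL-Algebra.Multiplicative_Group"
    "HOL-Algebra.Generated_Groups"
    "Jordan_Normal_Form.Matrix"
begin

section \<open>The Jordan algebra of upper triangular matrices\<close>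

definition UJ :: "nat \<Rightarrow> 'k::field mat set" where
  "UJ n = {A \<in> carrier_mat n n. upper_triangular A}"

definition jordan_prod :: "'k::field mat \<Rightarrow> 'k mat \<Rightarrow> 'k mat" where
  "jordan_prod A B = A * B + B * A"

definition subspace_UJ :: "nat \<Rightarrow> 'k::field mat set \<Rightarrow> bool" where
  "subspace_UJ n W \<longleftrightarrow> W \<subseteq> UJ n \<and> 0\<^sub>m n n \<in> W \<and>
     (\<forall>A\<in>W. \<forall>B\<in>W. A + B \<in> W) \<and> (\<forall>c. \<forall>A\<in>W. c \<cdot>\<^sub>m A \<in> W)"


section \<open>Group gradings\<close>

text \<open>
  A grading is a family of subspaces indexed by \<open>carrier G\<close>; values of the family outside
  \<open>carrier G\<close> play no role. Directness of the sum is existence and uniqueness of the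
  decomposition of every element into finitely many nonzero components.
\<close>

definition direct_decomposition ::
    "('g, 'b) monoid_scheme \<Rightarrow> nat \<Rightarrow> ('g \<Rightarrow> 'k::field mat set) \<Rightarrow> bool" where
  "direct_decomposition G n \<Gamma> \<longleftrightarrow>
     (\<forall>g\<in>carrier G. subspace_UJ n (\<Gamma> g)) \<and>
     (\<forall>A\<in>UJ n. \<exists>!f. f \<in> (\<Pi>\<^sub>E g\<in>carrier G. \<Gamma> g) \<and>
        finite {g \<in> carrier G. f g \<noteq> 0\<^sub>m n n} \<and>
        A = finsum (module_mat TYPE('k) n n) f {g \<in> carrier G. f g \<noteq> 0\<^sub>m n n})"

definition grading ::
    "('g, 'b) monoid_scheme \<Rightarrow> nat \<Rightarrow> ('g \<Rightarrow> 'k::field mat set) \<Rightarrow> bool" where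
  "grading G n \<Gamma> \<longleftrightarrow> direct_decomposition G n \<Gamma> \<and>
     (\<forall>g\<in>carrier G. \<forall>h\<in>carrier G. \<forall>A\<in>\<Gamma> g. \<forall>B\<in>\<Gamma> h.
        jordan_prod A B \<in> \<Gamma> (g \<otimes>\<^bsub>G\<^esub> h))"

definition homogeneous ::
    "('g, 'b) monoid_scheme \<Rightarrow> nat \<Rightarrow> ('g \<Rightarrow> 'k::field mat set) \<Rightarrow> 'k mat \<Rightarrow> bool" where
  "homogeneous G n \<Gamma> A \<longleftrightarrow> A \<noteq> 0\<^sub>m n n \<and> (\<exists>g\<in>carrier G. A \<in> \<Gamma> g)"

text \<open>Meaningful for homogeneous elements of a grading only.\<close>

definition hdeg ::
    "('g, 'b) monoid_scheme \<Rightarrow> ('g \<Rightarrow> 'k::field mat set) \<Rightarrow> 'k mat \<Rightarrow> 'g" where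
  "hdeg G \<Gamma> A = (THE g. g \<in> carrier G \<and> A \<in> \<Gamma> g)"

definition support ::
    "('g, 'b) monoid_scheme \<Rightarrow> nat \<Rightarrow> ('g \<Rightarrow> 'k::field mat set) \<Rightarrow> 'g set" where
  "support G n \<Gamma> = {g \<in> carrier G. \<Gamma> g \<noteq> {0\<^sub>m n n}}"

text \<open>
  For \<open>n = 2\<close> gradings of mirror type need not have commutative support: if \<open>t\<close> has order 2 and
  \<open>g\<close> is an arbitrary third degree, then \<open>1\<close>, \<open>e\<^sub>1\<^sub>1 - e\<^sub>2\<^sub>2\<close>, \<open>e\<^sub>1\<^sub>2\<close> of degrees \<open>1\<close>, \<open>t\<close>, \<open>g\<close> define
  a grading, since the Jordan product of the last two vanishes.
\<close>

definition commutative_support ::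
    "('g, 'b) monoid_scheme \<Rightarrow> nat \<Rightarrow> ('g \<Rightarrow> 'k::field mat set) \<Rightarrow> bool" where
  "commutative_support G n \<Gamma> \<longleftrightarrow>
     (\<forall>g\<in>support G n \<Gamma>. \<forall>h\<in>support G n \<Gamma>. g \<otimes>\<^bsub>G\<^esub> h = h \<otimes>\<^bsub>G\<^esub> g)"

definition graded_iso ::
    "('g, 'b) monoid_scheme \<Rightarrow> nat \<Rightarrow> ('g \<Rightarrow> 'k::field mat set) \<Rightarrow> ('g \<Rightarrow> 'k mat set) \<Rightarrow> bool"
  where
  "graded_iso G n \<Gamma> \<Gamma>' \<longleftrightarrow> (\<exists>\<phi>.
     bij_betw \<phi> (UJ n) (UJ n) \<and>
     (\<forall>A\<in>UJ n. \<forall>B\<in>UJ n. \<phi> (A + B) = \<phi> A + \<phi> B) \<and>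
     (\<forall>c. \<forall>A\<in>UJ n. \<phi> (c \<cdot>\<^sub>m A) = c \<cdot>\<^sub>m \<phi> A) \<and>
     (\<forall>A\<in>UJ n. \<forall>B\<in>UJ n. \<phi> (jordan_prod A B) = jordan_prod (\<phi> A) (\<phi> B)) \<and>
     (\<forall>g\<in>carrier G. \<phi> ` \<Gamma> g = \<Gamma>' g))"


section \<open>Gradings of mirror type\<close>

text \<open>
  The indices of the matrix units start at 1, whereas matrix entries are accessed from 0.
  The elements below are used only for \<open>1 \<le> i\<close> and \<open>i + m \<le> n\<close>, so that the subtractions
  of natural numbers do not truncate.
\<close>

definition munit :: "nat \<Rightarrow> nat \<Rightarrow> nat \<Rightarrow> 'k::field mat" where
  "munit n i j = mat n n (\<lambda>(r, c). if r + 1 = i \<and> c + 1 = j then 1 else 0)"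

definition e_pos :: "nat \<Rightarrow> nat \<Rightarrow> nat \<Rightarrow> 'k::field mat" where
  "e_pos n i m = munit n i (i + m)"

definition e_neg :: "nat \<Rightarrow> nat \<Rightarrow> nat \<Rightarrow> 'k::field mat" where
  "e_neg n i m = munit n (n - i - m + 1) (n - i + 1)"

definition Y_plus :: "nat \<Rightarrow> nat \<Rightarrow> nat \<Rightarrow> 'k::field mat" where
  "Y_plus n i m = e_pos n i m + e_neg n i m"

definition Y_minus :: "nat \<Rightarrow> nat \<Rightarrow> nat \<Rightarrow> 'k::field mat" where
  "Y_minus n i m = e_pos n i m - e_neg n i m"

definition MT_grading ::
    "('g, 'b) monoid_scheme \<Rightarrow> nat \<Rightarrow> ('g \<Rightarrow> 'k::field mat set) \<Rightarrow> bool" where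
  "MT_grading G n \<Gamma> \<longleftrightarrow> grading G n \<Gamma> \<and>
     (\<forall>i m. 1 \<le> i \<and> i + m \<le> n \<longrightarrow>
        homogeneous G n \<Gamma> (Y_plus n i m) \<and>
        (Y_minus n i m \<noteq> (0\<^sub>m n n :: 'k mat) \<longrightarrow>
           homogeneous G n \<Gamma> (Y_minus n i m) \<and>
           hdeg G \<Gamma> (Y_plus n i m) \<noteq> hdeg G \<Gamma> (Y_minus n i m)))"

definition MT_gradings ::
    "('g, 'b) monoid_scheme \<Rightarrow> nat \<Rightarrow> ('g \<Rightarrow> 'k::field mat set) set" where
  "MT_gradings G n = {\<Gamma>. MT_grading G n \<Gamma>}"

definition MT_iso_rel ::
    "('g, 'b) monoid_scheme \<Rightarrow> nat \<Rightarrow> (('g \<Rightarrow> 'k::field mat set) \<times> ('g \<Rightarrow> 'k mat set)) set" where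
  "MT_iso_rel G n =
     {(\<Gamma>, \<Gamma>'). \<Gamma> \<in> MT_gradings G n \<and> \<Gamma>' \<in> MT_gradings G n \<and> graded_iso G n \<Gamma> \<Gamma>'}"


section \<open>The parameter sets\<close>

text \<open>A power \<open>X\<^sup>k\<close> is the set of functions from \<open>{..<k}\<close> to \<open>X\<close>.\<close>

definition M_odd :: "('g, 'b) monoid_scheme \<Rightarrow> nat \<Rightarrow> ('g \<times> (nat \<Rightarrow> 'g set)) set" where
  "M_odd G n = {(t, \<eta>). t \<in> carrier G \<and> group.ord G t = 2 \<and>
     \<eta> \<in> {..<(n - 1) div 2} \<rightarrow>\<^sub>E carrier (G Mod generate G {t})}"

definition M_even ::
    "('g, 'b) monoid_scheme \<Rightarrow> nat \<Rightarrow> ('g \<times> ((nat \<Rightarrow> 'g set) \<times> 'g)) set" where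
  "M_even G n = {(t, \<eta>). t \<in> carrier G \<and> group.ord G t = 2 \<and>
     \<eta> \<in> ({..<(n - 2) div 2} \<rightarrow>\<^sub>E carrier (G Mod generate G {t})) \<times> carrier G}"

end

(* Reflection in the antidiagonal is an anti-automorphism of the associative algebra of upper
   triangular matrices, hence an automorphism of the Jordan algebra; Y+ and Y- span its
   eigenspaces for 1 and -1. In a grading of mirror type all diagonal Y- have the same degree t,
   t has order 2, deg Y- = t deg Y+ at every position not fixed by the reflection, and deg Y+ at
   (r, c) is the product of its values on the superdiagonal between r and c. Multiplying each
   superdiagonal value with the next one shows that all these degrees commute, with n = 2 as the
   only exception.

   For abelian G the grading is thus determined by t and the symmetric sequence of superdiagonal
   degrees, and every such datum occurs. Conjugation by a diagonal matrix of signs exchanges Y+ and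
   Y- at a chosen pair of mirror positions, so that outside the centre only the class modulo t
   matters. Conversely an automorphism permutes the diagonals of the idempotents e_ii, and its
   action on the strictly upper triangular matrices modulo their square shows that this permutation
   preserves adjacency, hence is the identity or the reversal; this makes t and the classes of the
   superdiagonal degrees invariants. *)

theory Submission
  imports Defs
begin

text \<open>The definition of a grading by unique finite decompositions is too indirect for reading
  off degrees. It is replaced by equations between entries at mirror positions: up to a factor 2,
  the sum of the two entries is the Y+ coefficient and their difference the Y- coefficient, and a
  homogeneous element with a nonzero coefficient reveals the degree at that position. Every relation
  between degrees thus reduces to one nonvanishing coefficient of one Jordan product. Such a product
  lies in the components of both gh and hg, because the Jordan product is commutative; this yields
  commutation relations in an arbitrary group. The recurring obstacle is a position that is its own
  mirror image, where Y- vanishes. At the central superdiagonal position for even n this has two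
  effects. No sign change can multiply its degree by t, so this degree is itself an invariant,
  whence the factor G; and t commutes with it only by way of a neighbouring step, which n = 2 does
  not have. Of an automorphism, only diagonal and superdiagonal entries of images are used.\<close>

lemma two_neq_zero_field: "CHAR('k::field) \<noteq> 2 \<Longrightarrow> (2::'k) \<noteq> 0"
proof
  assume c: "CHAR('k) \<noteq> 2" and "(2::'k) = 0"
  then have "CHAR('k) dvd 2"
    using of_nat_eq_0_iff_char_dvd[where 'a='k and n=2] by simp
  then have "CHAR('k) \<le> 2" by (rule dvd_imp_le) simp
  moreover have "CHAR('k) > 0" using \<open>CHAR('k) dvd 2\<close> by (rule dvd_pos_nat[rotated]) simp
  moreover have "CHAR('k) \<noteq> 1" by simp
  ultimately show False using c by linarith
qed

text \<open>Applied with the gradings as \<open>X\<close> and their parameters as \<open>f\<close>: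
  once isomorphism is known to be equality of parameters, it remains to see that \<open>f\<close>
  has values in \<open>Y\<close> and exhausts it.\<close>

lemma bij_betw_quotient_fibres:
  assumes "\<And>x. x \<in> X \<Longrightarrow> f x \<in> Y" and "\<And>y. y \<in> Y \<Longrightarrow> \<exists>x\<in>X. f x = y"
  shows "\<exists>F. bij_betw F (X // {(x, y). x \<in> X \<and> y \<in> X \<and> f x = f y}) Y"
proof -
  let ?R = "{(x, y). x \<in> X \<and> y \<in> X \<and> f x = f y}"
  \<comment> \<open>Any element of a class may represent it, since \<open>f\<close> is constant on
    classes.\<close>
  define F where "F C = f (SOME x. x \<in> C)" for C
  have F: "F (?R `` {x}) = f x" if "x \<in> X" for x
  proof -
    have "x \<in> ?R `` {x}" using that by simp
    then have "(SOME y. y \<in> ?R `` {x}) \<in> ?R `` {x}" by (rule someI)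
    moreover have "\<forall>y\<in>?R `` {x}. f y = f x" by auto
    ultimately show ?thesis unfolding F_def by (rule bspec[rotated])
  qed
  have "inj_on F (X // ?R)"
  proof (rule inj_onI)
    fix C D assume "C \<in> X // ?R" "D \<in> X // ?R" and eq: "F C = F D"
    then obtain x y where xy: "x \<in> X" "y \<in> X" "C = ?R `` {x}" "D = ?R `` {y}"
      unfolding quotient_def by blast
    then have "f x = f y" using eq F by simp
    then have "?R `` {x} = ?R `` {y}" using xy(1,2) by (simp add: Image_def)
    then show "C = D" using xy(3,4) by (simp only:)
  qed
  moreover have "F ` (X // ?R) = Y"
  proof -
    have "X // ?R = (\<lambda>x. ?R `` {x}) ` X" by (auto simp: quotient_def)
    then have "F ` (X // ?R) = (\<lambda>x. F (?R `` {x})) ` X" by (simp add: image_image)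
    also have "\<dots> = f ` X" using F by (intro image_cong) auto
    also have "f ` X = Y" using assms by blast
    finally show ?thesis .
  qed
  ultimately show ?thesis unfolding bij_betw_def by blast
qed


section \<open>Upper triangular matrices\<close>

lemma UJ_iff: "A \<in> UJ n \<longleftrightarrow> A \<in> carrier_mat n n \<and> (\<forall>r c. c < r \<longrightarrow> r < n \<longrightarrow> A $$ (r, c) = 0)"
  by (auto simp: UJ_def upper_triangular_def)

lemma UJ_carrier [dest]: "A \<in> UJ n \<Longrightarrow> A \<in> carrier_mat n n"
  by (simp add: UJ_def)

lemma UJ_add: "A \<in> UJ n \<Longrightarrow> B \<in> UJ n \<Longrightarrow> A + B \<in> UJ n"
  by (auto simp: UJ_iff)

lemma UJ_smult: "A \<in> UJ n \<Longrightarrow> a \<cdot>\<^sub>m A \<in> UJ n"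
  by (auto simp: UJ_iff)

lemma UJ_zero: "0\<^sub>m n n \<in> UJ n"
  by (auto simp: UJ_iff)

lemma jordan_prod_index:
  assumes "A \<in> carrier_mat n n" "B \<in> carrier_mat n n" "i < n" "j < n"
  shows "jordan_prod A B $$ (i, j) =
    (\<Sum>k<n. A $$ (i, k) * B $$ (k, j) + B $$ (i, k) * A $$ (k, j))"
  using assms
  by (auto simp: jordan_prod_def scalar_prod_def sum.distrib lessThan_atLeast0)

lemma jordan_prod_carrier:
  "A \<in> carrier_mat n n \<Longrightarrow> B \<in> carrier_mat n n \<Longrightarrow> jordan_prod A B \<in> carrier_mat n n"
  by (auto simp: jordan_prod_def)

lemma jordan_prod_commute:
  assumes "A \<in> carrier_mat n n" "B \<in> carrier_mat n n"
  shows "jordan_prod A B = jordan_prod B A"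
  using assms unfolding jordan_prod_def by (intro comm_add_mat[where nr=n and nc=n]) auto

text \<open>Turns the sum in the module of matrices, in which \<open>direct_decomposition\<close> is
  stated, into sums of field elements, one for each entry.\<close>

lemma finsum_mat_index:
  fixes f :: "'s \<Rightarrow> 'k::field mat"
  assumes "finite S" "f \<in> S \<rightarrow> carrier_mat n n"
  shows "finsum (module_mat TYPE('k) n n) f S =
    mat n n (\<lambda>ij. \<Sum>s\<in>S. f s $$ ij)"
proof -
  interpret M: abelian_group "module_mat TYPE('k) n n" by (rule abelian_group_mat)
  show ?thesis using assms
  proof (induction S)
    case empty
    then show ?case by (auto simp: module_mat_simps)
  next
    case (insert s S)
    then have s: "f s \<in> carrier_mat n n" by auto
    have "finsum (module_mat TYPE('k) n n) f (insert s S) =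
        f s + finsum (module_mat TYPE('k) n n) f S"
      using insert.hyps insert.prems
      by (subst M.finsum_insert) (auto simp: module_mat_simps)
    also have "\<dots> = f s + mat n n (\<lambda>ij. \<Sum>s\<in>S. f s $$ ij)"
      using insert by simp
    also have "\<dots> = mat n n (\<lambda>ij. \<Sum>s\<in>insert s S. f s $$ ij)"
      using insert.hyps s by (auto intro!: eq_matI)
    finally show ?case .
  qed
qed

lemma subspace_UJ_sum:
  fixes W :: "'k::field mat set"
  assumes W: "subspace_UJ n W" and "finite X" "\<And>x. x \<in> X \<Longrightarrow> F x \<in> W"
  shows "mat n n (\<lambda>ij. \<Sum>x\<in>X. F x $$ ij) \<in> W"
  using assms(2,3)
proof (induction X)
  case empty
  have "mat n n (\<lambda>ij. \<Sum>x\<in>{}. F x $$ ij) = 0\<^sub>m n n" by (rule eq_matI) auto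
  then show ?case using W by (simp add: subspace_UJ_def)
next
  case (insert x X)
  then have x: "F x \<in> W" by simp
  then have "F x \<in> carrier_mat n n" using W by (auto simp: subspace_UJ_def)
  then have "mat n n (\<lambda>ij. \<Sum>x\<in>insert x X. F x $$ ij) =
      F x + mat n n (\<lambda>ij. \<Sum>x\<in>X. F x $$ ij)"
    using insert.hyps by (auto intro!: eq_matI)
  then show ?case using insert x W by (simp add: subspace_UJ_def)
qed


section \<open>Direct decompositions\<close>

text \<open>A decomposition of an element of \<open>\<Gamma> g\<close> along the smaller family
  \<open>\<Delta>\<close> is also one along \<open>\<Gamma>\<close>, so by uniqueness it is
  concentrated in degree g. Hence for two direct decompositions one inclusion is enough.\<close>

lemma direct_decomposition_eqI:
  fixes \<Gamma> \<Delta> :: "'g \<Rightarrow> 'k::field mat set"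
  assumes \<Gamma>: "direct_decomposition G n \<Gamma>" and \<Delta>: "direct_decomposition G n \<Delta>"
    and sub: "\<And>g. g \<in> carrier G \<Longrightarrow> \<Delta> g \<subseteq> \<Gamma> g" and g: "g \<in> carrier G"
  shows "\<Gamma> g = \<Delta> g"
proof
  show "\<Gamma> g \<subseteq> \<Delta> g"
  proof
    fix A assume A: "A \<in> \<Gamma> g"
    then have AU: "A \<in> UJ n" using \<Gamma> g by (auto simp: direct_decomposition_def subspace_UJ_def)
    let ?P = "\<lambda>\<Gamma> f. f \<in> (\<Pi>\<^sub>E g\<in>carrier G. \<Gamma> g) \<and>
        finite {g \<in> carrier G. f g \<noteq> 0\<^sub>m n n} \<and>
        A = finsum (module_mat TYPE('k) n n) f {g \<in> carrier G. f g \<noteq> 0\<^sub>m n n}"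
    define s where "s = (\<lambda>x\<in>carrier G. if x = g then A else 0\<^sub>m n n)"
    \<comment> \<open>The zero matrix has no nonzero component, hence the case distinction.\<close>
    have "{x \<in> carrier G. s x \<noteq> 0\<^sub>m n n} = (if A = 0\<^sub>m n n then {} else {g})"
      using g by (auto simp: s_def)
    then have "?P \<Gamma> s"
      using A g \<Gamma> AU
      by (auto simp: finsum_mat_index s_def direct_decomposition_def subspace_UJ_def intro!: eq_matI)
    obtain f where f: "?P \<Delta> f" using \<Delta> AU unfolding direct_decomposition_def by blast
    then have "?P \<Gamma> f" using sub by (auto simp: PiE_iff)
    moreover have "\<exists>!f. ?P \<Gamma> f" using \<Gamma> AU unfolding direct_decomposition_def by blast
    ultimately have "f = s" using \<open>?P \<Gamma> s\<close> by blast
    then have "f g = A" using g by (simp add: s_def)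
    then show "A \<in> \<Delta> g" using f g by (auto simp: PiE_iff)
  qed
qed (use sub g in auto)

text \<open>Placing the nonzero \<open>A\<close> in degree \<open>g\<close> or in degree
  \<open>h\<close> gives two decompositions of it, and these must coincide.\<close>

lemma direct_decomposition_unique_degree:
  fixes \<Gamma> :: "'g \<Rightarrow> 'k::field mat set"
  assumes \<Gamma>: "direct_decomposition G n \<Gamma>" and gh: "g \<in> carrier G" "h \<in> carrier G"
    and A: "A \<in> \<Gamma> g" "A \<in> \<Gamma> h" "A \<noteq> 0\<^sub>m n n"
  shows "g = h"
proof -
  have AU: "A \<in> UJ n" using \<Gamma> gh A by (auto simp: direct_decomposition_def subspace_UJ_def)
  let ?P = "\<lambda>f. f \<in> (\<Pi>\<^sub>E g\<in>carrier G. \<Gamma> g) \<and>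
      finite {g \<in> carrier G. f g \<noteq> 0\<^sub>m n n} \<and>
      A = finsum (module_mat TYPE('k) n n) f {g \<in> carrier G. f g \<noteq> 0\<^sub>m n n}"
  define s where "s y = (\<lambda>x\<in>carrier G. if x = y then A else 0\<^sub>m n n)" for y
  have "?P (s y)" if "y \<in> carrier G" "A \<in> \<Gamma> y" for y
  proof -
    have "{x \<in> carrier G. s y x \<noteq> 0\<^sub>m n n} = {y}"
      using that A by (auto simp: s_def)
    then show ?thesis
      using that \<Gamma> AU
      by (auto simp: finsum_mat_index s_def direct_decomposition_def subspace_UJ_def intro!: eq_matI)
  qed
  moreover have "\<exists>!f. ?P f" using \<Gamma> AU unfolding direct_decomposition_def by blast
  ultimately have "s g = s h" using gh A by blast
  then have "s g g = s h g" by simp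
  then show ?thesis using A gh by (simp add: s_def split: if_splits)
qed

section \<open>Mirror decompositions\<close>

text \<open>Rows and columns are counted from 0 from here on, so that the mirror image of the
  position \<open>(r, c)\<close> is \<open>(n - Suc c, n - Suc r)\<close>.\<close>

definition mirror_decomp ::
    "nat \<Rightarrow> (nat \<Rightarrow> nat \<Rightarrow> 'g) \<Rightarrow> (nat \<Rightarrow> nat \<Rightarrow> 'g) \<Rightarrow> 'g \<Rightarrow> 'k::field mat set" where
  "mirror_decomp n p q g = {A \<in> UJ n. \<forall>r c. r \<le> c \<longrightarrow> c < n \<longrightarrow>
     (p r c \<noteq> g \<longrightarrow> A $$ (r, c) + A $$ (n - Suc c, n - Suc r) = 0) \<and>
     (q r c \<noteq> g \<longrightarrow> A $$ (r, c) = A $$ (n - Suc c, n - Suc r))}"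

text \<open>The values 1, -1 and 0 of x give Y+, Y- and the plain matrix unit. The mirror position
  is expressed by sums equal to n, which avoids truncated subtraction.\<close>

definition Ymat :: "nat \<Rightarrow> 'k \<Rightarrow> nat \<Rightarrow> nat \<Rightarrow> 'k::field mat" where
  "Ymat n x r c = mat n n (\<lambda>(i, j). (if i = r \<and> j = c then 1 else 0) +
     (if Suc (i + c) = n \<and> Suc (j + r) = n then x else 0))"

lemma mirror_decompI:
  assumes "A \<in> UJ n"
    and "\<And>r c. r \<le> c \<Longrightarrow> c < n \<Longrightarrow> p r c \<noteq> g \<Longrightarrow> A $$ (r, c) + A $$ (n - Suc c, n - Suc r) = 0"
    and "\<And>r c. r \<le> c \<Longrightarrow> c < n \<Longrightarrow> q r c \<noteq> g \<Longrightarrow> A $$ (r, c) = A $$ (n - Suc c, n - Suc r)"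
  shows "A \<in> mirror_decomp n p q g"
  unfolding mirror_decomp_def by (intro CollectI conjI allI impI assms)

text \<open>The sum of two mirror entries measures the Y+ part and their difference the Y- part; a
  part that does not vanish must have degree g.\<close>

lemma mirror_decompD:
  assumes "A \<in> mirror_decomp n p q g" "r \<le> c" "c < n"
  shows "A $$ (r, c) + A $$ (n - Suc c, n - Suc r) \<noteq> 0 \<Longrightarrow> p r c = g"
    and "A $$ (r, c) \<noteq> A $$ (n - Suc c, n - Suc r) \<Longrightarrow> q r c = g"
  using assms by (auto simp: mirror_decomp_def)

lemma Ymat_carrier [simp]: "Ymat n x r c \<in> carrier_mat n n"
  by (simp add: Ymat_def)

lemma dim_Ymat [simp]: "dim_row (Ymat n x r c) = n" "dim_col (Ymat n x r c) = n"
  by (simp_all add: Ymat_def)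

lemma Ymat_index: "i < n \<Longrightarrow> j < n \<Longrightarrow> Ymat n x r c $$ (i, j) =
    (if i = r \<and> j = c then 1 else 0) + (if Suc (i + c) = n \<and> Suc (j + r) = n then x else 0)"
  by (simp add: Ymat_def)

lemma Y_plus_conv: "r \<le> c \<Longrightarrow> c < n \<Longrightarrow> Y_plus n (Suc r) (c - r) = Ymat n 1 r c"
  by (rule eq_matI) (auto simp: Y_plus_def e_pos_def e_neg_def munit_def Ymat_def)

lemma Y_minus_conv: "r \<le> c \<Longrightarrow> c < n \<Longrightarrow> Y_minus n (Suc r) (c - r) = Ymat n (- 1) r c"
  by (rule eq_matI) (auto simp: Y_minus_def e_pos_def e_neg_def munit_def Ymat_def)

lemma Ymat_mirror:
  assumes rc: "r < n" "c < n"
  shows "Ymat n 1 (n - Suc c) (n - Suc r) = Ymat n 1 r c"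
    and "Ymat n (- 1) (n - Suc c) (n - Suc r) = - 1 \<cdot>\<^sub>m Ymat n (- 1) r c"
proof -
  have "i = n - Suc c \<longleftrightarrow> Suc (i + c) = n" "Suc (i + (n - Suc c)) = n \<longleftrightarrow> i = c"
    "i = n - Suc r \<longleftrightarrow> Suc (i + r) = n" "Suc (i + (n - Suc r)) = n \<longleftrightarrow> i = r" for i
    using rc by auto
  then show "Ymat n 1 (n - Suc c) (n - Suc r) = Ymat n 1 r c"
    "Ymat n (- 1) (n - Suc c) (n - Suc r) = - 1 \<cdot>\<^sub>m Ymat n (- 1) r c"
    by (auto intro!: eq_matI simp: Ymat_index)
qed

lemma Ymat_plus_neq_zero:
  assumes "(2::'k::field) \<noteq> 0" "r < n" "c < n"
  shows "Ymat n 1 r c \<noteq> (0\<^sub>m n n :: 'k mat)"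
proof
  assume "Ymat n 1 r c = (0\<^sub>m n n :: 'k mat)"
  then have "Ymat n 1 r c $$ (r, c) = (0\<^sub>m n n :: 'k mat) $$ (r, c)" by simp
  then show False using assms by (simp add: Ymat_index split: if_splits)
qed

lemma Ymat_minus_eq_zero_iff:
  assumes "r < n" "c < n"
  shows "Ymat n (- 1) r c = (0\<^sub>m n n :: 'k::field mat) \<longleftrightarrow> Suc (r + c) = n"
proof
  assume "Ymat n (- 1) r c = (0\<^sub>m n n :: 'k mat)"
  then have "Ymat n (- 1) r c $$ (r, c) = (0\<^sub>m n n :: 'k mat) $$ (r, c)" by simp
  then show "Suc (r + c) = n" using assms by (simp add: Ymat_index split: if_splits)
next
  assume "Suc (r + c) = n"
  then have "Suc (i + c) = n \<longleftrightarrow> i = r" "Suc (j + r) = n \<longleftrightarrow> j = c" for i j by auto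
  then show "Ymat n (- 1) r c = (0\<^sub>m n n :: 'k mat)"
    by (intro eq_matI) (simp_all add: Ymat_index)
qed

lemma subspace_mirror_decomp: "subspace_UJ n (mirror_decomp n p q g :: 'k::field mat set)"
proof -
  have *: "A \<in> carrier_mat n n" if "A \<in> mirror_decomp n p q g" for A :: "'k mat"
    using that by (auto simp: mirror_decomp_def)
  show ?thesis
    unfolding subspace_UJ_def
  proof (intro conjI ballI allI)
    fix A B :: "'k mat" assume A: "A \<in> mirror_decomp n p q g" and B: "B \<in> mirror_decomp n p q g"
    have "(A + B) $$ (r, c) + (A + B) $$ (n - Suc c, n - Suc r) =
       (A $$ (r, c) + A $$ (n - Suc c, n - Suc r)) + (B $$ (r, c) + B $$ (n - Suc c, n - Suc r))"
      if "r \<le> c" "c < n" for r c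
      using that *[OF A] *[OF B] by auto
    then show "A + B \<in> mirror_decomp n p q g"
      using A B *[OF A] *[OF B] by (auto simp: mirror_decomp_def UJ_add simp del: index_add_mat)
        (auto)
  next
    fix a and A :: "'k mat" assume A: "A \<in> mirror_decomp n p q g"
    have "(a \<cdot>\<^sub>m A) $$ (r, c) + (a \<cdot>\<^sub>m A) $$ (n - Suc c, n - Suc r) =
       a * (A $$ (r, c) + A $$ (n - Suc c, n - Suc r))"
      if "r \<le> c" "c < n" for r c
      using that *[OF A] by (auto simp: algebra_simps)
    then show "a \<cdot>\<^sub>m A \<in> mirror_decomp n p q g"
      using A *[OF A] by (auto simp: mirror_decomp_def UJ_smult simp del: index_smult_mat) auto
  qed (auto simp: mirror_decomp_def UJ_zero)
qed

text \<open>Half the sum and half the difference of mirror entries split a matrix into its Y+ and Y-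
  parts; the symmetry of p and q under the reflection puts each part into a single
  component.\<close>

lemma direct_decomposition_mirror_decomp:
  fixes G (structure)
  assumes two: "(2::'k::field) \<noteq> 0"
    and p: "\<And>r c. r \<le> c \<Longrightarrow> c < n \<Longrightarrow> p r c \<in> carrier G \<and> p (n - Suc c) (n - Suc r) = p r c"
    and q: "\<And>r c. r \<le> c \<Longrightarrow> c < n \<Longrightarrow> q r c \<in> carrier G \<and> q (n - Suc c) (n - Suc r) = q r c"
  shows "direct_decomposition G n (mirror_decomp n p q :: _ \<Rightarrow> 'k mat set)"
  unfolding direct_decomposition_def
proof (intro conjI ballI)
  fix A :: "'k mat" assume A: "A \<in> UJ n"
  let ?D = "mirror_decomp n p q :: _ \<Rightarrow> 'k mat set"
  let ?S = "\<lambda>f. {g \<in> carrier G. f g \<noteq> (0\<^sub>m n n :: 'k mat)}"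
  let ?P = "\<lambda>f. f \<in> (\<Pi>\<^sub>E g\<in>carrier G. ?D g) \<and> finite (?S f) \<and>
      A = finsum (module_mat TYPE('k) n n) f (?S f)"
  have index: "A $$ (i, j) = (\<Sum>g\<in>?S f. f g $$ (i, j))" if f: "?P f" "i < n" "j < n" for f i j
  proof -
    have "f \<in> ?S f \<rightarrow> carrier_mat n n" using f by (auto simp: mirror_decomp_def PiE_iff)
    then show ?thesis using f finsum_mat_index[of "?S f" f n] by simp
  qed
  show "\<exists>!f. ?P f"
  proof (rule ex_ex1I)
    \<comment> \<open>Component g collects the Y+ parts of the positions with p = g and the Y- parts
      of those with q = g.\<close>
    define f where "f = (\<lambda>g\<in>carrier G. mat n n (\<lambda>(r, c).
        (if p r c = g then (A $$ (r, c) + A $$ (n - Suc c, n - Suc r)) / 2 else 0) +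
        (if q r c = g then (A $$ (r, c) - A $$ (n - Suc c, n - Suc r)) / 2 else 0)))"
    have f_index: "f g $$ (r, c) =
        (if p r c = g then (A $$ (r, c) + A $$ (n - Suc c, n - Suc r)) / 2 else 0) +
        (if q r c = g then (A $$ (r, c) - A $$ (n - Suc c, n - Suc r)) / 2 else 0)"
      if "g \<in> carrier G" "r < n" "c < n" for g r c
      using that by (simp add: f_def)
    have lower: "A $$ (r, c) = 0" "A $$ (n - Suc c, n - Suc r) = 0" if "c < r" "r < n" for r c
      using that A by (auto simp: UJ_iff)
    have f_carrier: "f g \<in> carrier_mat n n" if "g \<in> carrier G" for g
      using that by (simp add: f_def)
    have f_UJ: "f g \<in> UJ n" if "g \<in> carrier G" for g
      unfolding UJ_iff using that f_carrier lower by (auto simp: f_index)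
    have fD: "f g \<in> ?D g" if g: "g \<in> carrier G" for g
    proof -
      have "(p r c \<noteq> g \<longrightarrow> f g $$ (r, c) + f g $$ (n - Suc c, n - Suc r) = 0) \<and>
            (q r c \<noteq> g \<longrightarrow> f g $$ (r, c) = f g $$ (n - Suc c, n - Suc r))"
        if "r \<le> c" "c < n" for r c
      proof -
        have "n - Suc c < n" "n - Suc r < n" "n - Suc (n - Suc r) = r" "n - Suc (n - Suc c) = c"
          using that by auto
        then show ?thesis using that p[OF that] q[OF that] g
          by (auto simp: f_index add_divide_distrib[symmetric] diff_divide_distrib[symmetric])
      qed
      then show ?thesis using f_UJ[OF g] unfolding mirror_decomp_def by blast
    qed
    \<comment> \<open>Only finitely many degrees occur, namely values of p and q on the n by n
      square.\<close>
    let ?V = "(\<lambda>(r, c). p r c) ` ({..<n} \<times> {..<n}) \<union> (\<lambda>(r, c). q r c) ` ({..<n} \<times> {..<n})"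
    have "?S f \<subseteq> ?V"
    proof
      fix g assume "g \<in> ?S f"
      then have g: "g \<in> carrier G" "f g \<noteq> 0\<^sub>m n n" by auto
      then obtain r c where rc: "r < n" "c < n" "f g $$ (r, c) \<noteq> 0"
        using f_carrier[of g] by (auto simp: mat_eq_iff)
      then have "p r c = g \<or> q r c = g" using g by (auto simp: f_index split: if_splits)
      then show "g \<in> ?V" using rc by force
    qed
    then have fin: "finite (?S f)" by (rule finite_subset) simp
    have "A = finsum (module_mat TYPE('k) n n) f (?S f)"
    proof (rule eq_matI)
      have fs: "finsum (module_mat TYPE('k) n n) f (?S f) = mat n n (\<lambda>ij. \<Sum>g\<in>?S f. f g $$ ij)"
        using fin f_carrier by (intro finsum_mat_index) auto
      fix r c assume "r < dim_row (finsum (module_mat TYPE('k) n n) f (?S f))"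
        "c < dim_col (finsum (module_mat TYPE('k) n n) f (?S f))"
      then have rc: "r < n" "c < n" by (auto simp: fs)
      have "(\<Sum>g\<in>?S f. f g $$ (r, c)) = A $$ (r, c)"
      proof (cases "r \<le> c")
        case True
        have "(\<Sum>g\<in>?S f. f g $$ (r, c)) = (\<Sum>g\<in>?S f \<union> {p r c, q r c}. f g $$ (r, c))"
          using fin p[OF True] q[OF True] rc by (intro sum.mono_neutral_left) auto
        also have "\<dots> = (\<Sum>g\<in>?S f \<union> {p r c, q r c}.
          (if p r c = g then (A $$ (r, c) + A $$ (n - Suc c, n - Suc r)) / 2 else 0) +
          (if q r c = g then (A $$ (r, c) - A $$ (n - Suc c, n - Suc r)) / 2 else 0))"
          using p[OF True] q[OF True] rc by (intro sum.cong) (auto simp: f_index)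
        also have "\<dots> = A $$ (r, c)"
          using fin two by (simp add: sum.distrib field_simps)
        finally show ?thesis .
      next
        case False
        then show ?thesis using rc lower f_UJ by (intro trans[OF sum.neutral]) (auto simp: UJ_iff)
      qed
      then show "A $$ (r, c) = finsum (module_mat TYPE('k) n n) f (?S f) $$ (r, c)"
        using rc by (simp add: fs)
    next
      show "dim_row A = dim_row (finsum (module_mat TYPE('k) n n) f (?S f))"
        "dim_col A = dim_col (finsum (module_mat TYPE('k) n n) f (?S f))"
        using A fin f_carrier by (auto simp: finsum_mat_index)
    qed
    then show "\<exists>f. ?P f" using fin fD by (intro exI[of _ f]) (auto simp: f_def)
  next
    fix f1 f2 assume f1: "?P f1" and f2: "?P f2"
    \<comment> \<open>For uniqueness: in the sum over all degrees, the Y+ coefficient at (r, c)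
      survives only in degree \<open>p r c\<close> and the Y- coefficient only in degree
      \<open>q r c\<close>, so both are determined by A.\<close>
    have sums: "f (p r c) $$ (r, c) + f (p r c) $$ (n - Suc c, n - Suc r) =
          A $$ (r, c) + A $$ (n - Suc c, n - Suc r) \<and>
        f (q r c) $$ (r, c) - f (q r c) $$ (n - Suc c, n - Suc r) =
          A $$ (r, c) - A $$ (n - Suc c, n - Suc r)"
      if f: "?P f" and rc: "r \<le> c" "c < n" for f r c
    proof -
      have fD: "f g \<in> ?D g" if "g \<in> carrier G" for g using f that by auto
      have mn: "n - Suc c < n" "n - Suc r < n" "r < n" using rc by auto
      have "A $$ (r, c) + A $$ (n - Suc c, n - Suc r) =
          (\<Sum>g\<in>?S f. f g $$ (r, c) + f g $$ (n - Suc c, n - Suc r))"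
        using index[OF f] mn rc by (simp add: sum.distrib)
      also have "\<dots> = (\<Sum>g\<in>insert (p r c) (?S f).
          f g $$ (r, c) + f g $$ (n - Suc c, n - Suc r))"
        using f p[OF rc] mn rc by (intro sum.mono_neutral_left) auto
      also have "\<dots> = (\<Sum>g\<in>insert (p r c) (?S f).
          if p r c = g then f g $$ (r, c) + f g $$ (n - Suc c, n - Suc r) else 0)"
        using p[OF rc] mirror_decompD(1)[OF fD rc] by (intro sum.cong) auto
      also have "\<dots> = f (p r c) $$ (r, c) + f (p r c) $$ (n - Suc c, n - Suc r)"
        using f by simp
      finally have 1: "f (p r c) $$ (r, c) + f (p r c) $$ (n - Suc c, n - Suc r) =
          A $$ (r, c) + A $$ (n - Suc c, n - Suc r)" by simp
      have "A $$ (r, c) - A $$ (n - Suc c, n - Suc r) =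
          (\<Sum>g\<in>?S f. f g $$ (r, c) - f g $$ (n - Suc c, n - Suc r))"
        using index[OF f] mn rc by (simp add: sum_subtractf)
      also have "\<dots> = (\<Sum>g\<in>insert (q r c) (?S f).
          f g $$ (r, c) - f g $$ (n - Suc c, n - Suc r))"
        using f q[OF rc] mn rc by (intro sum.mono_neutral_left) auto
      also have "\<dots> = (\<Sum>g\<in>insert (q r c) (?S f).
          if q r c = g then f g $$ (r, c) - f g $$ (n - Suc c, n - Suc r) else 0)"
        using q[OF rc] mirror_decompD(2)[OF fD rc] by (intro sum.cong) auto
      also have "\<dots> = f (q r c) $$ (r, c) - f (q r c) $$ (n - Suc c, n - Suc r)"
        using f by simp
      finally show ?thesis using 1 by simp
    qed
    have "f1 g = f2 g" if g: "g \<in> carrier G" for g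
    proof -
      have D: "f1 g \<in> ?D g" "f2 g \<in> ?D g" using f1 f2 g by auto
      then have U: "f1 g \<in> UJ n" "f2 g \<in> UJ n" by (auto simp: mirror_decomp_def)
      have "f1 g $$ (r, c) = f2 g $$ (r, c)" if "r < n" "c < n" for r c
      proof (cases "r \<le> c")
        case True
        let ?x = "\<lambda>f. f g $$ (r, c)" and ?y = "\<lambda>f. f g $$ (n - Suc c, n - Suc r)"
        have plus: "p r c \<noteq> g \<Longrightarrow> ?x f + ?y f = 0" if "f g \<in> ?D g" for f
          using mirror_decompD(1)[OF that True] \<open>c < n\<close> by blast
        have minus: "q r c \<noteq> g \<Longrightarrow> ?x f = ?y f" if "f g \<in> ?D g" for f
          using mirror_decompD(2)[OF that True] \<open>c < n\<close> by blast
        have "?x f1 + ?y f1 = ?x f2 + ?y f2"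
          using sums[OF f1 True] sums[OF f2 True] plus[of f1, OF D(1)] plus[of f2, OF D(2)] that
          by (cases "p r c = g") simp_all
        moreover have "?x f1 - ?y f1 = ?x f2 - ?y f2"
          using sums[OF f1 True] sums[OF f2 True] minus[of f1, OF D(1)] minus[of f2, OF D(2)] that
          by (cases "q r c = g") simp_all
        \<comment> \<open>Adding the two equations recovers twice the entry.\<close>
        ultimately have "(?x f1 + ?y f1) + (?x f1 - ?y f1) = (?x f2 + ?y f2) + (?x f2 - ?y f2)"
          by simp
        then have "2 * ?x f1 = 2 * ?x f2" by (simp add: algebra_simps)
        then show ?thesis using two by simp
      next
        case False
        then show ?thesis using that U by (auto simp: UJ_iff)
      qed
      then show ?thesis using U by (intro eq_matI) (auto dest!: UJ_carrier)
    qed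
    moreover have "f1 \<in> Pi\<^sub>E (carrier G) ?D" "f2 \<in> Pi\<^sub>E (carrier G) ?D" using f1 f2 by blast+
    ultimately show "f1 = f2" by (intro PiE_ext)
  qed
qed (rule subspace_mirror_decomp)

section \<open>Entries of Jordan products with Y+ and Y-\<close>

lemma powers_of_two_neq_zero:
  assumes "(2::'k::field) \<noteq> 0"
  shows "(4::'k) \<noteq> 0" "(8::'k) \<noteq> 0" "(16::'k) \<noteq> 0"
  using assms power_not_zero[of "2::'k" 2] power_not_zero[of "2::'k" 3] power_not_zero[of "2::'k" 4]
  by simp_all

text \<open>Left multiplication by \<open>Ymat n x a b\<close> picks two rows and right
  multiplication two columns, so four terms remain.\<close>

lemma jordan_prod_Ymat_index:
  fixes B :: "'k::field mat"
  assumes "B \<in> carrier_mat n n" "a < n" "b < n" "i < n" "j < n"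
  shows "jordan_prod (Ymat n x a b) B $$ (i, j) =
    (if i = a then B $$ (b, j) else 0) + (if Suc (i + b) = n then x * B $$ (n - Suc a, j) else 0) +
    ((if j = b then B $$ (i, a) else 0) + (if Suc (j + a) = n then x * B $$ (i, n - Suc b) else 0))"
proof -
  have delta: "(\<Sum>k<n. ((if P \<and> k = u then 1 else 0) + (if Q \<and> k = v then x else 0)) * F k) =
      (if P then F u else 0) + (if Q then x * F v else 0)"
    if "u < n" "v < n" for P Q u v and F :: "nat \<Rightarrow> 'k"
    using that by (cases P; cases Q)
      (simp_all add: distrib_right sum.distrib if_distrib[where f="\<lambda>y. y * _"] cong: if_cong)
  have row: "(\<Sum>k<n. Ymat n x a b $$ (i, k) * B $$ (k, j)) =
      (if i = a then B $$ (b, j) else 0) + (if Suc (i + b) = n then x * B $$ (n - Suc a, j) else 0)"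
    using assms(2-5)
    by (subst delta[symmetric]) (auto intro!: sum.cong simp: Ymat_index)
  have col: "(\<Sum>k<n. B $$ (i, k) * Ymat n x a b $$ (k, j)) =
      (if j = b then B $$ (i, a) else 0) + (if Suc (j + a) = n then x * B $$ (i, n - Suc b) else 0)"
    using assms(2-5)
    by (subst delta[symmetric]) (auto intro!: sum.cong simp: Ymat_index)
  show ?thesis
    using assms by (simp add: jordan_prod_index[where n=n] sum.distrib row col)
qed

lemma hdeg_eq:
  assumes "direct_decomposition G n \<Gamma>" "g \<in> carrier G" "A \<in> \<Gamma> g" "A \<noteq> 0\<^sub>m n n"
  shows "hdeg G \<Gamma> A = g"
  unfolding hdeg_def
  using assms by (intro the_equality) (auto intro: direct_decomposition_unique_degree)


section \<open>The structure of gradings of mirror type\<close>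

locale mirror_type = group G for G (structure) +
  fixes n :: nat and \<Gamma> :: "'a \<Rightarrow> 'k::field mat set"
  assumes two: "(2::'k) \<noteq> 0" and MT: "MT_grading G n \<Gamma>"
begin

definition degp :: "nat \<Rightarrow> nat \<Rightarrow> 'a" where
  "degp r c = hdeg G \<Gamma> (Ymat n 1 r c)"

text \<open>If \<open>(r, c)\<close> is its own mirror image then \<open>Ymat n (- 1) r c = 0\<close>, and any element of the
  group would do as its degree.\<close>

definition degm :: "nat \<Rightarrow> nat \<Rightarrow> 'a" where
  "degm r c = (if Suc (r + c) = n then degp r c else hdeg G \<Gamma> (Ymat n (- 1) r c))"

lemma decomp: "direct_decomposition G n \<Gamma>"
  using MT by (simp add: MT_grading_def grading_def)

lemma subspace: "g \<in> carrier G \<Longrightarrow> subspace_UJ n (\<Gamma> g)"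
  using decomp by (simp add: direct_decomposition_def)

lemma jordan_closed:
  "\<lbrakk>g \<in> carrier G; h \<in> carrier G; A \<in> \<Gamma> g; B \<in> \<Gamma> h\<rbrakk> \<Longrightarrow> jordan_prod A B \<in> \<Gamma> (g \<otimes> h)"
  using MT by (simp add: MT_grading_def grading_def)

lemma hdeg_homogeneous:
  assumes "homogeneous G n \<Gamma> A"
  shows "hdeg G \<Gamma> A \<in> carrier G" "A \<in> \<Gamma> (hdeg G \<Gamma> A)"
  using assms hdeg_eq[OF decomp] by (auto simp: homogeneous_def)

lemma homogeneous_Ymat:
  assumes "r \<le> c" "c < n"
  shows "homogeneous G n \<Gamma> (Ymat n 1 r c)"
    and "Suc (r + c) \<noteq> n \<Longrightarrow> homogeneous G n \<Gamma> (Ymat n (- 1) r c)"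
    and "Suc (r + c) \<noteq> n \<Longrightarrow>
      hdeg G \<Gamma> (Ymat n 1 r c) \<noteq> hdeg G \<Gamma> (Ymat n (- 1) r c)"
proof -
  have "Suc r + (c - r) \<le> n" using assms by simp
  then have "homogeneous G n \<Gamma> (Y_plus n (Suc r) (c - r)) \<and>
      (Y_minus n (Suc r) (c - r) \<noteq> (0\<^sub>m n n :: 'k mat) \<longrightarrow>
        homogeneous G n \<Gamma> (Y_minus n (Suc r) (c - r)) \<and>
        hdeg G \<Gamma> (Y_plus n (Suc r) (c - r)) \<noteq> hdeg G \<Gamma> (Y_minus n (Suc r) (c - r)))"
    using MT unfolding MT_grading_def by simp
  then show "homogeneous G n \<Gamma> (Ymat n 1 r c)"
    and "Suc (r + c) \<noteq> n \<Longrightarrow> homogeneous G n \<Gamma> (Ymat n (- 1) r c)"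
    and "Suc (r + c) \<noteq> n \<Longrightarrow>
      hdeg G \<Gamma> (Ymat n 1 r c) \<noteq> hdeg G \<Gamma> (Ymat n (- 1) r c)"
    using assms by (simp_all add: Y_plus_conv Y_minus_conv Ymat_minus_eq_zero_iff)
qed

lemma degp:
  assumes "r \<le> c" "c < n"
  shows "degp r c \<in> carrier G" "Ymat n 1 r c \<in> \<Gamma> (degp r c)"
  using hdeg_homogeneous[OF homogeneous_Ymat(1)[OF assms]] by (simp_all add: degp_def)

lemma degm:
  assumes "r \<le> c" "c < n"
  shows "degm r c \<in> carrier G" "Ymat n (- 1) r c \<in> \<Gamma> (degm r c)"
proof -
  have "degm r c \<in> carrier G \<and> Ymat n (- 1) r c \<in> \<Gamma> (degm r c)"
  proof (cases "Suc (r + c) = n")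
    case True
    then have "Ymat n (- 1) r c = (0\<^sub>m n n :: 'k mat)"
      using assms by (simp add: Ymat_minus_eq_zero_iff)
    then show ?thesis using True degp[OF assms] subspace by (simp add: degm_def subspace_UJ_def)
  next
    case False
    then show ?thesis
      using hdeg_homogeneous[OF homogeneous_Ymat(2)[OF assms]] by (simp add: degm_def)
  qed
  then show "degm r c \<in> carrier G" "Ymat n (- 1) r c \<in> \<Gamma> (degm r c)" by simp_all
qed

lemma degm_neq_degp: "r \<le> c \<Longrightarrow> c < n \<Longrightarrow> Suc (r + c) \<noteq> n \<Longrightarrow> degm r c \<noteq> degp r c"
  using homogeneous_Ymat(3)[of r c] by (simp add: degm_def degp_def)

lemma degp_mirror:
  "r \<le> c \<Longrightarrow> c < n \<Longrightarrow> degp (n - Suc c) (n - Suc r) = degp r c"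
  by (simp add: degp_def Ymat_mirror)

lemma degm_mirror:
  assumes "r \<le> c" "c < n"
  shows "degm (n - Suc c) (n - Suc r) = degm r c"
proof (cases "Suc (r + c) = n")
  case True
  then have "n - Suc c = r" "n - Suc r = c" by auto
  then show ?thesis by simp
next
  case False
  have "- 1 \<cdot>\<^sub>m Ymat n (- 1) r c \<in> \<Gamma> (degm r c)"
    using degm[OF assms] subspace by (simp add: subspace_UJ_def)
  then have Y: "Ymat n (- 1) (n - Suc c) (n - Suc r) \<in> \<Gamma> (degm r c)"
    using assms by (simp add: Ymat_mirror)
  have m: "n - Suc c < n" "n - Suc r < n" "Suc (n - Suc c + (n - Suc r)) \<noteq> n"
    using assms False by auto
  have "Ymat n (- 1) (n - Suc c) (n - Suc r) \<noteq> (0\<^sub>m n n :: 'k mat)"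
    using m by (simp add: Ymat_minus_eq_zero_iff)
  then have "hdeg G \<Gamma> (Ymat n (- 1) (n - Suc c) (n - Suc r)) = degm r c"
    using Y degm[OF assms] by (intro hdeg_eq[OF decomp])
  then show ?thesis using m by (simp add: degm_def)
qed

text \<open>The matrix is expanded in the homogeneous Y+ and Y-; by the defining equations only
  those of degree g receive nonzero coefficients.\<close>

lemma mirror_decomp_subset:
  assumes g: "g \<in> carrier G"
  shows "mirror_decomp n degp degm g \<subseteq> \<Gamma> g"
proof
  fix A :: "'k mat" assume A: "A \<in> mirror_decomp n degp degm g"
  then have AU: "A \<in> UJ n" by (simp add: mirror_decomp_def)
  note W = subspace[OF g]
  define s where "s r c = A $$ (r, c) + A $$ (n - Suc c, n - Suc r)" for r c
  define d where "d r c = A $$ (r, c) - A $$ (n - Suc c, n - Suc r)" for r c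
  define F where "F = (\<lambda>(r, c). s r c \<cdot>\<^sub>m Ymat n 1 r c + d r c \<cdot>\<^sub>m Ymat n (- 1) r c)"
  define X where "X = {..<n} \<times> {..<n}"
  have "F x \<in> \<Gamma> g" if x: "x \<in> X" for x
  proof -
    obtain r c where rc: "x = (r, c)" "r < n" "c < n" using x by (auto simp: X_def)
    have sd: "s r c \<cdot>\<^sub>m Ymat n 1 r c \<in> \<Gamma> g \<and> d r c \<cdot>\<^sub>m Ymat n (- 1) r c \<in> \<Gamma> g"
    proof (cases "r \<le> c")
      case True
      have "s r c \<noteq> 0 \<Longrightarrow> Ymat n 1 r c \<in> \<Gamma> g"
        using mirror_decompD(1)[OF A True rc(3)] degp[OF True rc(3)] by (auto simp: s_def)
      moreover have "d r c \<noteq> 0 \<Longrightarrow> Ymat n (- 1) r c \<in> \<Gamma> g"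
        using mirror_decompD(2)[OF A True rc(3)] degm[OF True rc(3)] by (auto simp: d_def)
      moreover have "0 \<cdot>\<^sub>m Ymat n x r c = (0\<^sub>m n n :: 'k mat)" for x by (intro eq_matI) auto
      ultimately show ?thesis
        using W unfolding subspace_UJ_def by (cases "s r c = 0"; cases "d r c = 0") simp_all
    next
      case False
      then have "s r c = 0" "d r c = 0"
        using AU rc by (auto simp: s_def d_def UJ_iff)
      moreover have "0 \<cdot>\<^sub>m Ymat n x r c = (0\<^sub>m n n :: 'k mat)" for x by (intro eq_matI) auto
      ultimately show ?thesis using W by (simp add: subspace_UJ_def)
    qed
    then show ?thesis using W rc by (simp add: F_def subspace_UJ_def)
  qed
  then have M: "mat n n (\<lambda>ij. \<Sum>x\<in>X. F x $$ ij) \<in> \<Gamma> g"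
    by (intro subspace_UJ_sum[OF W]) (auto simp: X_def)
  \<comment> \<open>The entry at (i, j) receives \<open>s + d\<close> from its own position and
    \<open>s - d\<close> from the mirror position, and each of them is twice the entry of A.\<close>
  have sum4: "(\<Sum>x\<in>X. F x $$ (i, j)) = 4 * A $$ (i, j)" if ij: "i < n" "j < n" for i j
  proof -
    have "F x $$ (i, j) = (if x = (i, j) then s i j + d i j else 0) +
        (if x = (n - Suc j, n - Suc i) then s (n - Suc j) (n - Suc i) - d (n - Suc j) (n - Suc i) else 0)"
      if x: "x \<in> X" for x
    proof -
      obtain r c where rc: "x = (r, c)" "r < n" "c < n" using x by (auto simp: X_def)
      define u v where uv: "u = n - Suc j" "v = n - Suc i"
      have "(Suc (i + c) = n \<and> Suc (j + r) = n) \<longleftrightarrow> (r = u \<and> c = v)"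
        unfolding uv using rc ij by linarith
      then show ?thesis unfolding uv[symmetric] using rc ij by (auto simp: F_def Ymat_index)
    qed
    then have "(\<Sum>x\<in>X. F x $$ (i, j)) = (\<Sum>x\<in>X. (if x = (i, j) then s i j + d i j else 0) +
        (if x = (n - Suc j, n - Suc i) then s (n - Suc j) (n - Suc i) - d (n - Suc j) (n - Suc i) else 0))"
      by (rule sum.cong[OF refl])
    also have "\<dots> = s i j + d i j + (s (n - Suc j) (n - Suc i) - d (n - Suc j) (n - Suc i))"
      using ij by (simp add: sum.distrib X_def)
    also have "\<dots> = 4 * A $$ (i, j)"
      using ij by (simp add: s_def d_def)
    finally show ?thesis .
  qed
  note powers_of_two_neq_zero[OF two]
  then have "A = inverse 4 \<cdot>\<^sub>m mat n n (\<lambda>ij. \<Sum>x\<in>X. F x $$ ij)"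
    using AU by (intro eq_matI) (auto dest!: UJ_carrier simp: sum4)
  then show "A \<in> \<Gamma> g" using M W unfolding subspace_UJ_def by metis
qed

text \<open>Both sides are direct decompositions, so the inclusion just shown suffices. From here on
  membership in a component is a statement about entries.\<close>

lemma component_eq_degm:
  assumes "g \<in> carrier G"
  shows "\<Gamma> g = mirror_decomp n degp degm g"
proof (rule direct_decomposition_eqI[OF decomp _ mirror_decomp_subset assms])
  show "direct_decomposition G n (mirror_decomp n degp degm :: _ \<Rightarrow> 'k mat set)"
    using degp(1) degm(1) degp_mirror degm_mirror
    by (intro direct_decomposition_mirror_decomp[OF two]) auto
qed

text \<open>The Jordan product does not depend on the order of its factors, so it lies in the
  components of gh and of hg. This is the source of all commutation relations between
  degrees.\<close>

lemma jordan_closed_mirror_decomp: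
  assumes gh: "g \<in> carrier G" "h \<in> carrier G" and AB: "A \<in> \<Gamma> g" "B \<in> \<Gamma> h"
  shows "jordan_prod A B \<in> mirror_decomp n degp degm (g \<otimes> h)"
    and "jordan_prod A B \<in> mirror_decomp n degp degm (h \<otimes> g)"
proof -
  have "A \<in> carrier_mat n n" "B \<in> carrier_mat n n"
    using subspace[OF gh(1)] subspace[OF gh(2)] AB by (auto simp: subspace_UJ_def)
  then have "jordan_prod B A = jordan_prod A B" by (rule jordan_prod_commute[symmetric])
  then have "jordan_prod A B \<in> \<Gamma> (h \<otimes> g)" using jordan_closed[OF gh(2,1) AB(2,1)] by simp
  then show "jordan_prod A B \<in> mirror_decomp n degp degm (h \<otimes> g)"
    using gh by (simp add: component_eq_degm)
  show "jordan_prod A B \<in> mirror_decomp n degp degm (g \<otimes> h)"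
    using gh jordan_closed[OF gh AB] by (simp add: component_eq_degm)
qed

section \<open>Relations between the degrees\<close>

lemma degp_eqI:
  assumes "g \<in> carrier G" "h \<in> carrier G" "A \<in> \<Gamma> g" "B \<in> \<Gamma> h" and rc: "r \<le> c" "c < n"
    and nz: "jordan_prod A B $$ (r, c) + jordan_prod A B $$ (n - Suc c, n - Suc r) \<noteq> 0"
  shows "degp r c = g \<otimes> h" "degp r c = h \<otimes> g"
  using jordan_closed_mirror_decomp[OF assms(1-4), THEN mirror_decompD(1), OF rc nz] by auto

lemma degm_eqI:
  assumes "g \<in> carrier G" "h \<in> carrier G" "A \<in> \<Gamma> g" "B \<in> \<Gamma> h" and rc: "r \<le> c" "c < n"
    and nz: "jordan_prod A B $$ (r, c) \<noteq> jordan_prod A B $$ (n - Suc c, n - Suc r)"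
  shows "degm r c = g \<otimes> h" "degm r c = h \<otimes> g"
  using jordan_closed_mirror_decomp[OF assms(1-4), THEN mirror_decompD(2), OF rc nz] by auto

text \<open>Y+ at a diagonal position squares to a nonzero multiple of itself, so its degree is
  idempotent in the group. The sum of the mirror entries is 4, or 16 at the centre, where Y+ is
  twice a matrix unit.\<close>

lemma degp_diag:
  assumes "r < n"
  shows "degp r r = \<one>"
proof -
  note powers_of_two_neq_zero[OF two]
  then have "degp r r = degp r r \<otimes> degp r r"
    using assms two degp[of r r]
    by (intro degp_eqI(1)[of _ _ "Ymat n 1 r r" "Ymat n 1 r r"])
      (auto simp: jordan_prod_Ymat_index Ymat_index)
  then show ?thesis using degp(1)[of r r] assms r_cancel_one' by blast
qed

text \<open>The Jordan square of a diagonal Y- is twice the Y+ at the same place, which has degree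
  \<open>\<one>\<close>.\<close>

lemma degm_diag_square:
  assumes "r < n" "Suc (r + r) \<noteq> n"
  shows "degm r r \<otimes> degm r r = \<one>"
proof -
  have "r \<noteq> n - Suc r" using assms by auto
  note powers_of_two_neq_zero[OF two]
  then have "degp r r = degm r r \<otimes> degm r r"
    using assms two degm[of r r] \<open>r \<noteq> n - Suc r\<close>
    by (intro degp_eqI(1)[of _ _ "Ymat n (- 1) r r" "Ymat n (- 1) r r"])
      (auto simp: jordan_prod_Ymat_index Ymat_index)
  then show ?thesis using degp_diag assms by simp
qed

lemma degp_mult:
  assumes "r < c" "c < e" "e < n"
  shows "degp r e = degp r c \<otimes> degp c e" "degp r e = degp c e \<otimes> degp r c"
proof -
  have "degp r c \<in> carrier G" "Ymat n 1 r c \<in> \<Gamma> (degp r c)"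
    "degp c e \<in> carrier G" "Ymat n 1 c e \<in> \<Gamma> (degp c e)"
    using assms degp by simp_all
  moreover have "jordan_prod (Ymat n 1 r c) (Ymat n 1 c e) $$ (r, e) +
      jordan_prod (Ymat n 1 r c) (Ymat n 1 c e) $$ (n - Suc e, n - Suc r) \<noteq> (0::'k)"
  proof -
    \<comment> \<open>As r + c < r + e < c + e, at most one of the three positions is its own mirror
      image. The sum of the mirror entries is 4 if one of them is, and 2 otherwise.\<close>
    consider "n = Suc (c + e)" | "n = Suc (r + c)" | "n = Suc (r + e)" |
      "Suc (c + e) \<noteq> n" "Suc (r + c) \<noteq> n" "Suc (r + e) \<noteq> n"
      by blast
    then show ?thesis
    proof cases
      case 4
      then have f: "Suc (e + c) \<noteq> n" "Suc (c + r) \<noteq> n" "Suc (e + r) \<noteq> n"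
        "n - Suc e \<noteq> r" "n - Suc r \<noteq> c" "n - Suc r \<noteq> e" "n - Suc e \<noteq> c" "e \<noteq> 0" "c \<noteq> 0"
        "Suc (n - Suc e + e) = n" "Suc (r + (n - Suc r)) = n" "Suc (n - Suc r + r) = n"
        "Suc (n - Suc e + c) \<noteq> n" "Suc (n - Suc r + c) \<noteq> n"
        "r < n" "c < n" "r \<noteq> c" "c \<noteq> e" "r \<noteq> e" "e \<noteq> c" "e \<noteq> r" "c \<noteq> r" "0 < n"
        using assms by auto
      show ?thesis
        by (simp add: f 4 \<open>e < n\<close> two jordan_prod_Ymat_index Ymat_index)
    qed (use assms two powers_of_two_neq_zero[OF two] in
        \<open>simp_all add: jordan_prod_Ymat_index Ymat_index\<close>)
  qed
  ultimately show "degp r e = degp r c \<otimes> degp c e" "degp r e = degp c e \<otimes> degp r c"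
    using assms degp_eqI[of "degp r c" "degp c e" "Ymat n 1 r c" "Ymat n 1 c e" r e] by simp_all
qed

text \<open>Apart from the excluded coincidences, Jordan multiplication by Y- at (r, r) sends Y+ at
  (r, c) to Y-. The version with (c, c) covers the case that (r, r) is the centre, where Y-
  vanishes.\<close>

lemma degm_left:
  assumes "r < c" "c < n" "Suc (r + r) \<noteq> n" "Suc (r + c) \<noteq> n"
  shows "degm r c = degm r r \<otimes> degp r c" "degm r c = degp r c \<otimes> degm r r"
proof -
  have f: "r \<noteq> n - Suc r" "r \<noteq> n - Suc c" "c \<noteq> n - Suc r"
    "n - Suc c \<noteq> r" "n - Suc r \<noteq> c" "n - Suc r \<noteq> r" "Suc (c + r) \<noteq> n"
    "Suc (n - Suc c + c) = n" "Suc (n - Suc r + r) = n"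
    "Suc (c + (n - Suc c)) = n" "Suc (r + (n - Suc r)) = n"
    "Suc (n - Suc c + r) \<noteq> n" "Suc (n - Suc r + c) \<noteq> n" "r \<noteq> c" "c \<noteq> r" "r < n" "0 < n"
    using assms by auto
  have "jordan_prod (Ymat n (- 1) r r) (Ymat n 1 r c) $$ (r, c) \<noteq>
      (jordan_prod (Ymat n (- 1) r r) (Ymat n 1 r c) $$ (n - Suc c, n - Suc r) :: 'k)"
    by (simp add: f assms two jordan_prod_Ymat_index Ymat_index eq_neg_iff_add_eq_0)
  then show "degm r c = degm r r \<otimes> degp r c" "degm r c = degp r c \<otimes> degm r r"
    using assms degp[of r c] degm[of r r]
      degm_eqI[of "degm r r" "degp r c" "Ymat n (- 1) r r" "Ymat n 1 r c" r c] by simp_all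
qed

lemma degm_right:
  assumes "r < c" "c < n" "Suc (c + c) \<noteq> n" "Suc (r + c) \<noteq> n"
  shows "degm r c = degm c c \<otimes> degp r c" "degm r c = degp r c \<otimes> degm c c"
proof -
  have f: "c \<noteq> n - Suc c" "r \<noteq> n - Suc c" "c \<noteq> n - Suc r"
    "n - Suc c \<noteq> r" "n - Suc r \<noteq> c" "n - Suc c \<noteq> c" "Suc (c + r) \<noteq> n"
    "Suc (n - Suc c + c) = n" "Suc (n - Suc r + r) = n"
    "Suc (c + (n - Suc c)) = n" "Suc (r + (n - Suc r)) = n"
    "Suc (n - Suc c + r) \<noteq> n" "Suc (n - Suc r + c) \<noteq> n" "r \<noteq> c" "c \<noteq> r" "r < n" "0 < n"
    using assms by auto
  have "jordan_prod (Ymat n (- 1) c c) (Ymat n 1 r c) $$ (r, c) \<noteq>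
      (jordan_prod (Ymat n (- 1) c c) (Ymat n 1 r c) $$ (n - Suc c, n - Suc r) :: 'k)"
    by (simp add: f assms two jordan_prod_Ymat_index Ymat_index eq_neg_iff_add_eq_0)
  then show "degm r c = degm c c \<otimes> degp r c" "degm r c = degp r c \<otimes> degm c c"
    using assms degp[of r c] degm[of c c]
      degm_eqI[of "degm c c" "degp r c" "Ymat n (- 1) c c" "Ymat n 1 r c" r c] by simp_all
qed

end

lemma (in group) commute_mult:
  assumes cl: "x \<in> carrier G" "y \<in> carrier G" "z \<in> carrier G"
    and "x \<otimes> y = y \<otimes> x" "x \<otimes> z = z \<otimes> x"
  shows "x \<otimes> (y \<otimes> z) = y \<otimes> z \<otimes> x"
proof -
  have "x \<otimes> (y \<otimes> z) = (y \<otimes> x) \<otimes> z" using assms by (simp flip: m_assoc)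
  also have "\<dots> = y \<otimes> (z \<otimes> x)" using assms by (simp add: m_assoc)
  finally show ?thesis using cl by (simp add: m_assoc)
qed

section \<open>The common degree of the diagonal Y- and commutativity of the support\<close>

context mirror_type
begin

text \<open>For n = 1 there is no nonzero diagonal Y-; the value \<open>\<one>\<close> keeps the
  closure and square rules valid there.\<close>

definition twist :: 'a where
  "twist = (if n = 1 then \<one> else degm 0 0)"

lemma twist_closed [simp]: "n \<ge> 1 \<Longrightarrow> twist \<in> carrier G"
  using degm(1)[of 0 0] by (simp add: twist_def)

lemma twist_square: "n \<ge> 1 \<Longrightarrow> twist \<otimes> twist = \<one>"
  using degm_diag_square[of 0] by (simp add: twist_def)

lemma twist_neq_one: "n \<ge> 2 \<Longrightarrow> twist \<noteq> \<one>"
  using degm_neq_degp[of 0 0] degp_diag[of 0] by (simp add: twist_def)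

text \<open>The degree at (0, r) of Y- is both \<open>degm 0 0\<close> and \<open>degm r r\<close>
  times that of Y+, which cancels. The last position r = n - 1 is not reached in this way, since (0,
  n - 1) is its own mirror image; it is the reflection of (0, 0) instead.\<close>

lemma degm_diag:
  assumes "r < n" "Suc (r + r) \<noteq> n"
  shows "degm r r = twist"
proof -
  have n: "n \<noteq> 1" "0 < n" using assms by auto
  consider "r = 0" | "Suc r = n" | "0 < r" "Suc r \<noteq> n" by blast
  then show ?thesis
  proof cases
    case 2
    then show ?thesis using n degm_mirror[of 0 0] by (auto simp: twist_def)
  next
    case 3
    then have "degm 0 0 \<otimes> degp 0 r = degm r r \<otimes> degp 0 r"
      using assms n degm_left(1)[of 0 r] degm_right(1)[of 0 r] by simp
    moreover have "degm 0 0 \<in> carrier G" "degm r r \<in> carrier G" "degp 0 r \<in> carrier G"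
      using assms n degm(1) degp(1) by simp_all
    ultimately show ?thesis using n by (simp add: twist_def)
  qed (use n in \<open>simp add: twist_def\<close>)
qed

lemma degm_eq:
  assumes "r \<le> c" "c < n" "Suc (r + c) \<noteq> n"
  shows "degm r c = degp r c \<otimes> twist" "degm r c = twist \<otimes> degp r c"
proof -
  have "degm r c = degp r c \<otimes> twist \<and> degm r c = twist \<otimes> degp r c"
  proof (cases "r = c")
    case True
    then show ?thesis using assms degm_diag degp_diag by simp
  next
    \<comment> \<open>At most one end of an off-diagonal position is the centre, so one of the two
      rules applies.\<close>
    case False
    then show ?thesis
      using assms degm_left[of r c] degm_right[of r c] degm_diag[of r] degm_diag[of c]
      by (cases "Suc (r + r) = n") simp_all
  qed
  then show "degm r c = degp r c \<otimes> twist" "degm r c = twist \<otimes> degp r c" by blast+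
qed

text \<open>At a self-mirror position the Y- condition compares an entry with itself, so
  \<open>degp r c \<otimes> twist\<close> can stand for the degree of Y- at all positions
  alike.\<close>

lemma component_eq:
  assumes "g \<in> carrier G"
  shows "\<Gamma> g = mirror_decomp n degp (\<lambda>r c. degp r c \<otimes> twist) g"
proof -
  have "A $$ (r, c) = A $$ (n - Suc c, n - Suc r)" if "Suc (r + c) = n" for A :: "'k mat" and r c
  proof -
    have "n - Suc c = r" "n - Suc r = c" using that by auto
    then show ?thesis by simp
  qed
  then have "mirror_decomp n degp degm g = (mirror_decomp n degp (\<lambda>r c. degp r c \<otimes> twist) g :: 'k mat set)"
    unfolding mirror_decomp_def using degm_eq(1) by (intro Collect_cong conj_cong refl) metis
  then show ?thesis using component_eq_degm[OF assms] by simp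
qed

text \<open>Adjacent intervals commute because \<open>degp_mult\<close> holds in both orders. Across
  a gap of degree y, the factor z commutes with y and with xy, hence with x.\<close>

lemma disjoint_degp_commute:
  assumes "r < c" "c \<le> e" "e < f" "f < n"
  shows "degp r c \<otimes> degp e f = degp e f \<otimes> degp r c"
proof (cases "c = e")
  case True
  then show ?thesis using assms degp_mult[of r e f] by simp
next
  case False
  define x y z where "x = degp r c" and "y = degp c e" and "z = degp e f"
  have cl: "x \<in> carrier G" "y \<in> carrier G" "z \<in> carrier G"
    using assms degp(1) by (simp_all add: x_def y_def z_def)
  have yz: "y \<otimes> z = z \<otimes> y" using assms False degp_mult[of c e f] by (simp add: y_def z_def)
  have "x \<otimes> y = degp r e" using assms False degp_mult(1)[of r c e] by (simp add: x_def y_def)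
  then have "x \<otimes> y \<otimes> z = z \<otimes> (x \<otimes> y)" using assms degp_mult[of r e f] by (simp add: z_def)
  then have "x \<otimes> z \<otimes> y = z \<otimes> x \<otimes> y" using cl yz by (simp add: m_assoc)
  then show ?thesis using cl unfolding x_def[symmetric] y_def[symmetric] z_def[symmetric] by simp
qed

text \<open>Where Y- is nonzero, the two forms of \<open>degm_eq\<close> give the claim. The central
  step is reached through the step before it: t commutes with the degree x of that step and with the
  degree xy of the two together, hence with y. For n = 2 there is no preceding step.\<close>

lemma twist_commute_step:
  assumes "Suc k < n" "n \<noteq> 2"
  shows "twist \<otimes> degp k (Suc k) = degp k (Suc k) \<otimes> twist"
proof (cases "Suc (k + Suc k) = n")
  case False
  then show ?thesis using assms degm_eq[of k "Suc k"] by simp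
next
  case True
  then obtain l where l: "k = Suc l" using assms by (cases k) auto
  define x y t where "x = degp l k" and "y = degp k (Suc k)" and "t = twist"
  have cl: "x \<in> carrier G" "y \<in> carrier G" "t \<in> carrier G"
    using assms l degp(1) by (simp_all add: x_def y_def t_def)
  have tx: "t \<otimes> x = x \<otimes> t" using True assms l degm_eq[of l k] by (simp add: x_def t_def)
  have "x \<otimes> y = degp l (Suc k)" using assms l degp_mult(1)[of l k "Suc k"] by (simp add: x_def y_def)
  then have "t \<otimes> (x \<otimes> y) = x \<otimes> y \<otimes> t"
    using True assms l degm_eq[of l "Suc k"] by (simp add: t_def)
  then have "x \<otimes> (t \<otimes> y) = x \<otimes> (y \<otimes> t)" using cl tx by (simp add: m_assoc[symmetric])
  then show ?thesis using cl unfolding y_def[symmetric] t_def[symmetric] by simp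
qed

lemma degp_Suc:
  assumes "r \<le> c" "Suc c < n"
  shows "degp r (Suc c) = degp r c \<otimes> degp c (Suc c)"
  using assms degp_mult(1)[of r c "Suc c"] degp_diag[of c] degp(1)[of c "Suc c"]
  by (cases "r = c") simp_all

lemma commute_degp:
  assumes x: "x \<in> carrier G" "\<And>k. Suc k < n \<Longrightarrow> x \<otimes> degp k (Suc k) = degp k (Suc k) \<otimes> x"
    and "r \<le> c" "c < n"
  shows "x \<otimes> degp r c = degp r c \<otimes> x"
  using assms(3,4)
proof (induction c rule: dec_induct)
  case base
  then show ?case using x by (simp add: degp_diag)
next
  case (step c)
  have "x \<otimes> (degp r c \<otimes> degp c (Suc c)) = degp r c \<otimes> degp c (Suc c) \<otimes> x"
    using step degp(1) x by (intro commute_mult) simp_all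
  then show ?case using step degp_Suc[of r c] by simp
qed

lemma commutative_support_of_mirror_type:
  assumes n: "n \<ge> 1" "n \<noteq> 2"
  shows "commutative_support G n \<Gamma>"
proof -
  define D where "D = insert twist {degp r c | r c. r \<le> c \<and> c < n}"
  have D_carrier: "D \<subseteq> carrier G" using degp(1) n by (auto simp: D_def)
  have D_step: "x \<otimes> degp k (Suc k) = degp k (Suc k) \<otimes> x" if x: "x \<in> D" and k: "Suc k < n" for x k
  proof -
    have *: "degp k (Suc k) \<otimes> degp l (Suc l) = degp l (Suc l) \<otimes> degp k (Suc k)" if "Suc l < n" for l
    proof (cases k l rule: linorder_cases)
      case less
      then show ?thesis using that disjoint_degp_commute[of k "Suc k" l "Suc l"] by simp
    next
      case greater
      then show ?thesis using k disjoint_degp_commute[of l "Suc l" k "Suc k"] by simp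
    qed simp
    have "degp k (Suc k) \<otimes> degp r c = degp r c \<otimes> degp k (Suc k)" if "r \<le> c" "c < n" for r c
    proof (rule commute_degp)
      show "degp k (Suc k) \<in> carrier G" using k degp(1) by simp
    qed (use * that in blast)+
    then show ?thesis using x n k twist_commute_step by (auto simp: D_def)
  qed
  have D_degp: "x \<otimes> degp r c = degp r c \<otimes> x" if "x \<in> D" "r \<le> c" "c < n" for x r c
  proof (rule commute_degp)
    show "x \<in> carrier G" using D_carrier that by blast
  qed (use D_step that in blast)+
  have DD: "x \<otimes> y = y \<otimes> x" if "x \<in> D" "y \<in> D" for x y
  proof -
    have cases: "z = twist \<or> (\<exists>r c. z = degp r c \<and> r \<le> c \<and> c < n)" if "z \<in> D" for z
      using that by (simp add: D_def)
    show ?thesis using cases[OF that(1)] cases[OF that(2)] D_degp[OF that(1)] D_degp[OF that(2)] by metis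
  qed
  \<comment> \<open>A support degree is \<open>degp r c\<close>, possibly times t. To have a product
    of two members of D in either case, \<open>degp 0 0\<close>, which equals \<open>\<one>\<close>,
    serves as the second factor when t is absent.\<close>
  have "\<exists>x\<in>D. \<exists>y\<in>D. g = x \<otimes> y" if g: "g \<in> support G n \<Gamma>" for g
  proof -
    have gc: "g \<in> carrier G" and "\<Gamma> g \<noteq> {0\<^sub>m n n}" using g by (auto simp: support_def)
    then obtain A where A: "A \<in> \<Gamma> g" "A \<noteq> 0\<^sub>m n n"
      using subspace[OF gc] by (auto simp: subspace_UJ_def)
    have AU: "A \<in> UJ n" using subspace[OF gc] A by (auto simp: subspace_UJ_def)
    then obtain r c where rc: "r < n" "c < n" "A $$ (r, c) \<noteq> 0"
      using A by (auto simp: mat_eq_iff dest!: UJ_carrier)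
    then have "r \<le> c" using AU unfolding UJ_iff by (meson not_le)
    have "A $$ (r, c) + A $$ (n - Suc c, n - Suc r) \<noteq> 0 \<or> A $$ (r, c) \<noteq> A $$ (n - Suc c, n - Suc r)"
    proof (rule ccontr)
      assume "\<not> ?thesis"
      then have "A $$ (r, c) + A $$ (r, c) = 0" by metis
      then show False using rc two by (metis mult_2 mult_eq_0_iff)
    qed
    then have "g = degp r c \<or> g = degp r c \<otimes> twist"
      using A mirror_decompD[of A n degp _ g, OF _ \<open>r \<le> c\<close> rc(2)]
      unfolding component_eq[OF gc] by blast
    moreover have "degp i j \<in> D" if "i \<le> j" "j < n" for i j
      using that unfolding D_def by blast
    then have "degp r c \<in> D" "degp 0 0 \<in> D" "twist \<in> D"
      using rc(2) \<open>r \<le> c\<close> by (simp_all add: D_def)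
    moreover have "degp r c \<otimes> degp 0 0 = degp r c"
      using rc \<open>r \<le> c\<close> degp_diag[of 0] degp(1) by simp
    ultimately show ?thesis by metis
  qed
  moreover have "(x \<otimes> y) \<otimes> (z \<otimes> w) = (z \<otimes> w) \<otimes> (x \<otimes> y)"
    if "x \<in> D" "y \<in> D" "z \<in> D" "w \<in> D" for x y z w
  proof -
    have cl: "x \<in> carrier G" "y \<in> carrier G" "z \<in> carrier G" "w \<in> carrier G"
      using that D_carrier by auto
    have "z \<otimes> (x \<otimes> y) = x \<otimes> y \<otimes> z" "w \<otimes> (x \<otimes> y) = x \<otimes> y \<otimes> w"
      using cl DD that by (auto intro!: commute_mult)
    then show ?thesis using cl by (intro commute_mult) simp_all
  qed
  ultimately show ?thesis unfolding commutative_support_def by metis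
qed

end

section \<open>Isomorphic gradings\<close>

text \<open>Conjugation by the diagonal matrix with entries s; as signs are their own inverses, both
  factors are values of s.\<close>

definition sign_conj :: "nat \<Rightarrow> (nat \<Rightarrow> 'k) \<Rightarrow> 'k mat \<Rightarrow> 'k::field mat" where
  "sign_conj n s A = mat n n (\<lambda>(i, j). s i * s j * A $$ (i, j))"

lemma sign_conj_index: "i < n \<Longrightarrow> j < n \<Longrightarrow> sign_conj n s A $$ (i, j) = s i * s j * A $$ (i, j)"
  by (simp add: sign_conj_def)

lemma sign_conj_carrier [simp]: "sign_conj n s A \<in> carrier_mat n n"
  by (simp add: sign_conj_def)

lemma sign_conj_UJ: "A \<in> UJ n \<Longrightarrow> sign_conj n s A \<in> UJ n"
  by (simp add: UJ_iff sign_conj_index)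

lemma sign_conj_involution:
  assumes "\<And>i. s i * s i = 1" "A \<in> carrier_mat n n"
  shows "sign_conj n s (sign_conj n s A) = A"
proof -
  have "s i * s j * (s i * s j * x) = x" for i j x
  proof -
    have "s i * s j * (s i * s j * x) = (s i * s i) * (s j * s j) * x" by (simp only: ac_simps)
    then show ?thesis using assms by simp
  qed
  then show ?thesis using assms(2) by (intro eq_matI) (auto simp: sign_conj_def)
qed

lemma sign_conj_jordan_prod:
  assumes s: "\<And>i. s i * s i = 1" and AB: "A \<in> carrier_mat n n" "B \<in> carrier_mat n n"
  shows "sign_conj n s (jordan_prod A B) = jordan_prod (sign_conj n s A) (sign_conj n s B)"
proof (rule eq_matI)
  have C: "jordan_prod (sign_conj n s A) (sign_conj n s B) \<in> carrier_mat n n"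
    by (simp add: jordan_prod_carrier)
  then show "dim_row (sign_conj n s (jordan_prod A B)) =
      dim_row (jordan_prod (sign_conj n s A) (sign_conj n s B))"
    "dim_col (sign_conj n s (jordan_prod A B)) =
      dim_col (jordan_prod (sign_conj n s A) (sign_conj n s B))"
    by (auto simp: sign_conj_def)
  fix i j assume "i < dim_row (jordan_prod (sign_conj n s A) (sign_conj n s B))"
    "j < dim_col (jordan_prod (sign_conj n s A) (sign_conj n s B))"
  then have ij: "i < n" "j < n" using C by auto
  have *: "s i * s k * x * (s k * s j * y) = s i * s j * (x * y)" for k x y
  proof -
    have "s i * s k * x * (s k * s j * y) = (s k * s k) * (s i * s j * (x * y))" by (simp only: ac_simps)
    then show ?thesis using s by simp
  qed
  show "sign_conj n s (jordan_prod A B) $$ (i, j) =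
      jordan_prod (sign_conj n s A) (sign_conj n s B) $$ (i, j)"
    using ij by (simp add: sign_conj_index jordan_prod_index[where n=n] AB * sum_distrib_left
        flip: distrib_left)
qed

lemma graded_iso_sign_conj:
  assumes s: "\<And>i. s i * s i = 1"
    and sub: "\<And>g. g \<in> carrier G \<Longrightarrow> sign_conj n s ` \<Gamma> g \<subseteq> \<Gamma>' g"
      "\<And>g. g \<in> carrier G \<Longrightarrow> sign_conj n s ` \<Gamma>' g \<subseteq> \<Gamma> g"
    and UJ: "\<And>g. g \<in> carrier G \<Longrightarrow> \<Gamma>' g \<subseteq> UJ n"
  shows "graded_iso G n \<Gamma> \<Gamma>'"
  unfolding graded_iso_def
proof (intro exI[of _ "sign_conj n s"] conjI ballI allI)
  have inv: "sign_conj n s (sign_conj n s A) = A" if "A \<in> UJ n" for A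
    using that by (intro sign_conj_involution s UJ_carrier)
  show "bij_betw (sign_conj n s) (UJ n) (UJ n)"
    by (rule bij_betw_byWitness[of _ "sign_conj n s"]) (auto simp: inv sign_conj_UJ)
  show "sign_conj n s (A + B) = sign_conj n s A + sign_conj n s B"
    if "A \<in> UJ n" "B \<in> UJ n" for A B
    using that[THEN UJ_carrier] by (intro eq_matI) (auto simp: sign_conj_def distrib_left)
  show "sign_conj n s (c \<cdot>\<^sub>m A) = c \<cdot>\<^sub>m sign_conj n s A" if "A \<in> UJ n" for c A
    using that[THEN UJ_carrier] by (intro eq_matI) (auto simp: sign_conj_def)
  show "sign_conj n s (jordan_prod A B) = jordan_prod (sign_conj n s A) (sign_conj n s B)"
    if "A \<in> UJ n" "B \<in> UJ n" for A B
    using that by (intro sign_conj_jordan_prod s UJ_carrier)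
  show "sign_conj n s ` \<Gamma> g = \<Gamma>' g" if g: "g \<in> carrier G" for g
  proof
    show "\<Gamma>' g \<subseteq> sign_conj n s ` \<Gamma> g"
    proof
      fix A assume A: "A \<in> \<Gamma>' g"
      then have "A = sign_conj n s (sign_conj n s A)" using inv UJ[OF g] by auto
      then show "A \<in> sign_conj n s ` \<Gamma> g" using sub(2)[OF g] A by blast
    qed
  qed (use sub(1)[OF g] in simp)
qed

text \<open>The entries at (r, c) and at its mirror image acquire signs whose ratio is the product
  of \<open>s r * s (n - Suc r)\<close> and \<open>s c * s (n - Suc c)\<close>. Ratio 1 preserves Y+
  and Y- up to sign, ratio -1 exchanges them.\<close>

lemma sign_conj_mirror_decomp:
  assumes neq: "(1::'k::field) \<noteq> - 1" and s: "\<And>i. s i = 1 \<or> s i = (- 1 :: 'k)"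
    and deg: "\<And>r c. r \<le> c \<Longrightarrow> c < n \<Longrightarrow>
      if s r * s (n - Suc r) = s c * s (n - Suc c)
      then p' r c = p r c \<and> q' r c = q r c else p' r c = q r c \<and> q' r c = p r c"
  shows "sign_conj n s ` mirror_decomp n p q g \<subseteq> mirror_decomp n p' q' g"
proof (rule image_subsetI)
  have signs: "(P' \<noteq> g \<longrightarrow> x * y * a + y' * x' * b = 0) \<and> (Q' \<noteq> g \<longrightarrow> x * y * a = y' * x' * b)"
    if "if x * x' = y * y' then P' = P \<and> Q' = Q else P' = Q \<and> Q' = P"
      and "P \<noteq> g \<Longrightarrow> b = - a" "Q \<noteq> g \<Longrightarrow> b = a"
      and "x = 1 \<or> x = - 1" "x' = 1 \<or> x' = - 1" "y = 1 \<or> y = - 1" "y' = 1 \<or> y' = - 1"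
    for x x' y y' a b :: 'k and P P' Q Q'
    using that(4-7) that(1-3) neq neq[symmetric]
    by (elim disjE) (cases "P = g"; cases "Q = g"; simp)+
  fix A :: "'k mat" assume A: "A \<in> mirror_decomp n p q g"
  have main: "(p' r c \<noteq> g \<longrightarrow> sign_conj n s A $$ (r, c) + sign_conj n s A $$ (n - Suc c, n - Suc r) = 0) \<and>
      (q' r c \<noteq> g \<longrightarrow> sign_conj n s A $$ (r, c) = sign_conj n s A $$ (n - Suc c, n - Suc r))"
    if rc: "r \<le> c" "c < n" for r c
  proof -
    have *: "p r c \<noteq> g \<Longrightarrow> A $$ (n - Suc c, n - Suc r) = - A $$ (r, c)"
      "q r c \<noteq> g \<Longrightarrow> A $$ (n - Suc c, n - Suc r) = A $$ (r, c)"
      using mirror_decompD[OF A rc] by (metis add.commute eq_neg_iff_add_eq_0)+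
    have i: "r < n" "n - Suc c < n" "n - Suc r < n" using rc by auto
    show ?thesis
      unfolding sign_conj_index[OF i(1) rc(2)] sign_conj_index[OF i(2,3)]
      by (rule signs[OF deg[OF rc] *(1) *(2) s s s s])
  qed
  have AU: "A \<in> UJ n" using A by (simp add: mirror_decomp_def)
  show "sign_conj n s A \<in> mirror_decomp n p' q' g"
    unfolding mirror_decomp_def
    by (rule CollectI, rule conjI[OF sign_conj_UJ[OF AU]], intro allI impI, rule main)
qed

lemma graded_iso_of_same_parameters:
  fixes G (structure) and \<Gamma> \<Gamma>' :: "'g \<Rightarrow> 'k::field mat set"
  assumes "comm_group G" and n: "n \<ge> 2"
    and A: "mirror_type G n \<Gamma>" and B: "mirror_type G n \<Gamma>'"
    and twist: "mirror_type.twist G n \<Gamma>' = mirror_type.twist G n \<Gamma>"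
    and steps: "\<And>k. k < (n - 1) div 2 \<Longrightarrow>
      mirror_type.degp G n \<Gamma>' k (Suc k) = mirror_type.degp G n \<Gamma> k (Suc k) \<or>
      mirror_type.degp G n \<Gamma>' k (Suc k) =
        mirror_type.degp G n \<Gamma> k (Suc k) \<otimes> mirror_type.twist G n \<Gamma>"
    and mid: "even n \<Longrightarrow> mirror_type.degp G n \<Gamma>' ((n - 2) div 2) (n div 2) =
      mirror_type.degp G n \<Gamma> ((n - 2) div 2) (n div 2)"
  shows "graded_iso G n \<Gamma> \<Gamma>'"
proof -
  interpret G: comm_group G by fact
  interpret A: mirror_type G n \<Gamma> by fact
  interpret B: mirror_type G n \<Gamma>' by fact
  define t where "t = A.twist"
  have t: "t \<in> carrier G" "t \<otimes> t = \<one>" "B.twist = t"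
    using A.twist_square n twist by (simp_all add: t_def)
  \<comment> \<open>\<open>x k\<close> is the sign change of s from k to k + 1. It is -1 exactly at
    the steps of the first half whose degrees differ; the second half is left alone, since equal
    signs at the two members of a mirror pair would cancel.\<close>
  define x :: "nat \<Rightarrow> 'k" where
    "x k = (if k < (n - 1) div 2 \<and> B.degp k (Suc k) \<noteq> A.degp k (Suc k) then - 1 else 1)" for k
  define s where "s k = prod x {..<k}" for k
  have x_sq: "x k * x k = 1" for k by (simp add: x_def)
  have s_Suc: "s (Suc k) = s k * x k" for k by (simp add: s_def)
  have s: "s k = 1 \<or> s k = - 1" for k
    by (induction k) (auto simp: s_Suc x_def, auto simp: s_def)
  have s_sq: "s k * s k = 1" for k using s[of k] by auto
  \<comment> \<open>By \<open>sign_conj_mirror_decomp\<close>, Y+ and Y- are exchanged at (r, c)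
    exactly if u takes different values at r and c.\<close>
  define u where "u k = s k * s (n - Suc k)" for k
  have u: "u k = 1 \<or> u k = - 1" for k using s[of k] s[of "n - Suc k"] by (auto simp: u_def)
  have u_step: "u k * u (Suc k) = x k * x (n - Suc (Suc k))" if "Suc k < n" for k
  proof -
    have "n - Suc k = Suc (n - Suc (Suc k))" using that by simp
    then have "u k * u (Suc k) = (s k * s k) * (s (n - Suc (Suc k)) * s (n - Suc (Suc k))) *
        (x k * x (n - Suc (Suc k)))"
      unfolding u_def by (simp only: s_Suc ac_simps)
    then show ?thesis by (simp add: s_sq)
  qed
  have neq: "(1::'k) \<noteq> - 1" using A.two by (metis add.right_inverse one_add_one)
  have step: "B.degp k (Suc k) = A.degp k (Suc k) \<otimes> (if u k * u (Suc k) = 1 then \<one> else t)"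
    if k: "Suc k < n" for k
  proof -
    have Ac: "A.degp l (Suc l) \<in> carrier G" if "Suc l < n" for l using A.degp(1) that by simp
    have *: "B.degp l (Suc l) = A.degp l (Suc l) \<otimes> (if x l = 1 then \<one> else t)"
      if "l < (n - 1) div 2" for l
    proof -
      have "Suc l < n" using that by linarith
      then have "A.degp l (Suc l) \<in> carrier G" by (rule Ac)
      then show ?thesis using steps[OF that] that neq unfolding x_def t_def
        by (cases "B.degp l (Suc l) = A.degp l (Suc l)") simp_all
    qed
    let ?m = "n - Suc (Suc k)"
    \<comment> \<open>Either the step lies in the first half, or its mirror image does, or it is the
      central step and equals its mirror image.\<close>
    consider "k < (n - 1) div 2" "\<not> ?m < (n - 1) div 2" | "?m < (n - 1) div 2" "\<not> k < (n - 1) div 2"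
      | "even n" "k = (n - 2) div 2" "Suc k = n div 2" "?m = k"
    proof -
      assume a: "k < (n - 1) div 2 \<Longrightarrow> \<not> ?m < (n - 1) div 2 \<Longrightarrow> thesis"
        "?m < (n - 1) div 2 \<Longrightarrow> \<not> k < (n - 1) div 2 \<Longrightarrow> thesis"
        "even n \<Longrightarrow> k = (n - 2) div 2 \<Longrightarrow> Suc k = n div 2 \<Longrightarrow> ?m = k \<Longrightarrow> thesis"
      show thesis
      proof (cases "k < (n - 1) div 2 \<or> ?m < (n - 1) div 2")
        case True
        then show thesis using a(1,2) k by linarith
      next
        case False
        define m where "m = ?m"
        have m: "k + m + 2 = n" "(n - 1) div 2 \<le> k" "(n - 1) div 2 \<le> m"
          using k False by (simp_all add: m_def not_less)
        then have "n - 1 = k + m + 1" by simp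
        then have "k = m" using m(2,3) by simp
        then have n: "n = Suc (Suc (k + k))" using m(1) by simp
        show thesis by (rule a(3)) (simp_all add: n)
      qed
    qed
    then show ?thesis
    proof cases
      case 1
      then have "x ?m = 1" by (simp add: x_def)
      then show ?thesis using *[of k] 1 u_step[OF k] by simp
    next
      case 2
      then have "x k = 1" by (simp add: x_def)
      moreover have "n - Suc (Suc ?m) = k" "n - Suc ?m = Suc k" "Suc ?m < n" using k 2 by linarith+
      then have "A.degp k (Suc k) = A.degp ?m (Suc ?m)" "B.degp k (Suc k) = B.degp ?m (Suc ?m)"
        using A.degp_mirror[of ?m "Suc ?m"] B.degp_mirror[of ?m "Suc ?m"] by simp_all
      ultimately show ?thesis using *[of ?m] 2 u_step[OF k] by simp
    next
      \<comment> \<open>At the centre a sign would enter squared, so no choice of signs alters this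
        degree; here the equality of the middle degrees is used.\<close>
      case 3
      then have "B.degp k (Suc k) = A.degp k (Suc k)" using mid by simp
      then show ?thesis using u_step[OF k] 3 x_sq[of k] Ac[OF k] by simp
    qed
  qed
  have degp: "B.degp r c = A.degp r c \<otimes> (if u r = u c then \<one> else t)" if "r \<le> c" "c < n" for r c
    using that
  proof (induction c rule: dec_induct)
    case base
    then show ?case by (simp add: A.degp_diag B.degp_diag)
  next
    case (step c)
    define a b where "a = A.degp r c" and "b = A.degp c (Suc c)"
    have ab: "a \<in> carrier G" "b \<in> carrier G" using step A.degp(1) by (simp_all add: a_def b_def)
    have "B.degp r (Suc c) = (a \<otimes> (if u r = u c then \<one> else t)) \<otimes>
        (b \<otimes> (if u c * u (Suc c) = 1 then \<one> else t))"
      using step B.degp_Suc[of r c] \<open>\<And>k. Suc k < n \<Longrightarrow> B.degp k (Suc k) = _\<close>[of c]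
      by (simp add: a_def b_def)
    also have "\<dots> = (a \<otimes> b) \<otimes> ((if u r = u c then \<one> else t) \<otimes> (if u c * u (Suc c) = 1 then \<one> else t))"
      using ab t by (simp add: G.m_ac)
    \<comment> \<open>As u has only the values 1 and -1, two exchanges undo each other, in
      accordance with t t = 1.\<close>
    also have "(if u r = u c then \<one> else t) \<otimes> (if u c * u (Suc c) = 1 then \<one> else t) =
        (if u r = u (Suc c) then \<one> else t)"
      using u[of r] u[of c] u[of "Suc c"] neq neq[symmetric] t by auto
    also have "a \<otimes> b = A.degp r (Suc c)" using step A.degp_Suc[of r c] by (simp add: a_def b_def)
    finally show ?case .
  qed
  have tt: "a \<otimes> t \<otimes> t = a" if "a \<in> carrier G" for a using that t by (simp add: G.m_assoc)
  show ?thesis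
  proof (rule graded_iso_sign_conj[of s, OF s_sq])
    fix g assume g: "g \<in> carrier G"
    show "sign_conj n s ` \<Gamma> g \<subseteq> \<Gamma>' g"
      unfolding A.component_eq[OF g] B.component_eq[OF g]
    proof (rule sign_conj_mirror_decomp[OF neq s])
      show "if s r * s (n - Suc r) = s c * s (n - Suc c)
        then B.degp r c = A.degp r c \<and> B.degp r c \<otimes> B.twist = A.degp r c \<otimes> A.twist
        else B.degp r c = A.degp r c \<otimes> A.twist \<and> B.degp r c \<otimes> B.twist = A.degp r c"
        if "r \<le> c" "c < n" for r c
        using degp[OF that] A.degp(1)[OF that] t tt unfolding u_def[symmetric] t_def[symmetric] by simp
    qed
    show "sign_conj n s ` \<Gamma>' g \<subseteq> \<Gamma> g"
      unfolding A.component_eq[OF g] B.component_eq[OF g]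
    proof (rule sign_conj_mirror_decomp[OF neq s])
      show "if s r * s (n - Suc r) = s c * s (n - Suc c)
        then A.degp r c = B.degp r c \<and> A.degp r c \<otimes> A.twist = B.degp r c \<otimes> B.twist
        else A.degp r c = B.degp r c \<otimes> B.twist \<and> A.degp r c \<otimes> A.twist = B.degp r c"
        if "r \<le> c" "c < n" for r c
        using degp[OF that] A.degp(1)[OF that] t tt unfolding u_def[symmetric] t_def[symmetric] by simp
    qed
    show "\<Gamma>' g \<subseteq> UJ n" using B.subspace[OF g] by (simp add: subspace_UJ_def)
  qed
qed

section \<open>Realization of the parameters\<close>

text \<open>The product of entries along r, k, c is paired with the product along the mirror path.
  The Y+ part of the pair comes from Y+ with Y+ and Y- with Y-, the Y- part from the mixed products,
  and t t = 1 makes the degrees fit. For k outside the interval from r to c both products vanish by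
  triangularity, so p is constrained only inside it.\<close>

lemma mirror_decomp_mult:
  fixes G (structure) and A B :: "'k::field mat"
  assumes "comm_group G" and two: "(2::'k) \<noteq> 0" and t: "t \<in> carrier G" "t \<otimes> t = \<one>"
    and p: "r \<le> k \<and> k \<le> c \<longrightarrow> p r k \<in> carrier G \<and> p k c \<in> carrier G \<and> p r c = p r k \<otimes> p k c"
    and A: "A \<in> mirror_decomp n p (\<lambda>r c. p r c \<otimes> t) g"
    and B: "B \<in> mirror_decomp n p (\<lambda>r c. p r c \<otimes> t) h"
    and rc: "r \<le> c" "c < n" "k < n"
  shows "p r c \<noteq> g \<otimes> h \<Longrightarrow> A $$ (r, k) * B $$ (k, c) +
      A $$ (n - Suc k, n - Suc r) * B $$ (n - Suc c, n - Suc k) = 0"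
    and "p r c \<otimes> t \<noteq> g \<otimes> h \<Longrightarrow> A $$ (r, k) * B $$ (k, c) =
      A $$ (n - Suc k, n - Suc r) * B $$ (n - Suc c, n - Suc k)"
proof -
  interpret comm_group G by fact
  define x x' y y' where defs: "x = A $$ (r, k)" "x' = A $$ (n - Suc k, n - Suc r)"
    "y = B $$ (k, c)" "y' = B $$ (n - Suc c, n - Suc k)"
  \<comment> \<open>The passage from entries to sums and differences, with a factor 2 in place of a
    division.\<close>
  have plus: "2 * (x * y + x' * y') = (x + x') * (y + y') + (x - x') * (y - y')"
    and minus: "2 * (x * y - x' * y') = (x + x') * (y - y') + (x - x') * (y + y')"
    by (simp_all add: algebra_simps)
  have "(p r c \<noteq> g \<otimes> h \<longrightarrow> x * y + x' * y' = 0) \<and> (p r c \<otimes> t \<noteq> g \<otimes> h \<longrightarrow> x * y = x' * y')"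
  proof (cases "r \<le> k \<and> k \<le> c")
    case True
    then have k: "r \<le> k" "k \<le> c" by simp_all
    define a b where ab: "a = p r k" "b = p k c"
    have cl: "a \<in> carrier G" "b \<in> carrier G" using p k by (simp_all add: ab)
    have pab: "p r c = a \<otimes> b" using p k unfolding ab by blast
    have Ad: "x + x' \<noteq> 0 \<Longrightarrow> a = g" "x \<noteq> x' \<Longrightarrow> a \<otimes> t = g"
      using mirror_decompD[OF A k(1) rc(3)] by (simp_all add: defs ab)
    have Bd: "y + y' \<noteq> 0 \<Longrightarrow> b = h" "y \<noteq> y' \<Longrightarrow> b \<otimes> t = h"
      using mirror_decompD[OF B k(2) rc(2)] by (simp_all add: defs ab)
    have ttab: "(a \<otimes> t) \<otimes> (b \<otimes> t) = a \<otimes> b"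
    proof -
      have "(a \<otimes> t) \<otimes> (b \<otimes> t) = (a \<otimes> b) \<otimes> (t \<otimes> t)" using cl t(1) by (simp only: m_ac m_closed)
      then show ?thesis using cl t by simp
    qed
    have tab: "a \<otimes> (b \<otimes> t) = a \<otimes> b \<otimes> t" "(a \<otimes> t) \<otimes> b = a \<otimes> b \<otimes> t"
      using cl t(1) by (simp_all add: m_ac)
    have "x * y + x' * y' = 0" if "p r c \<noteq> g \<otimes> h"
    proof -
      have "(x + x' = 0 \<or> y + y' = 0) \<and> (x = x' \<or> y = y')"
        using that Ad Bd ttab unfolding pab by metis
      then have "2 * (x * y + x' * y') = 0" unfolding plus by auto
      then show ?thesis using two by (metis mult_eq_0_iff)
    qed
    moreover have "x * y = x' * y'" if "p r c \<otimes> t \<noteq> g \<otimes> h"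
    proof -
      have "(x + x' = 0 \<or> y = y') \<and> (x = x' \<or> y + y' = 0)"
        using that Ad Bd tab unfolding pab by metis
      then have "2 * (x * y - x' * y') = 0" unfolding minus by auto
      then show ?thesis using two by (metis mult_eq_0_iff right_minus_eq)
    qed
    ultimately show ?thesis by blast
  next
    case False
    have "A \<in> UJ n" "B \<in> UJ n" using A B by (simp_all add: mirror_decomp_def)
    then have "x = 0 \<and> x' = 0 \<or> y = 0 \<and> y' = 0"
      using False rc unfolding defs UJ_iff by (cases "k < r") auto
    then show ?thesis by auto
  qed
  then show "p r c \<noteq> g \<otimes> h \<Longrightarrow> A $$ (r, k) * B $$ (k, c) +
      A $$ (n - Suc k, n - Suc r) * B $$ (n - Suc c, n - Suc k) = 0"
    and "p r c \<otimes> t \<noteq> g \<otimes> h \<Longrightarrow> A $$ (r, k) * B $$ (k, c) =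
      A $$ (n - Suc k, n - Suc r) * B $$ (n - Suc c, n - Suc k)"
    unfolding defs by blast+
qed

text \<open>The reflection reverses products, so the mirror image of a term of AB is a term of BA.
  The Jordan product contains both, and its mirror entries split into the pairs of
  \<open>mirror_decomp_mult\<close>.\<close>

lemma mirror_decomp_jordan_prod:
  fixes G (structure) and A B :: "'k::field mat"
  assumes G: "comm_group G" and two: "(2::'k) \<noteq> 0" and t: "t \<in> carrier G" "t \<otimes> t = \<one>"
    and p: "\<And>r c. r \<le> c \<Longrightarrow> c < n \<Longrightarrow> p r c \<in> carrier G"
      "\<And>r k c. r \<le> k \<Longrightarrow> k \<le> c \<Longrightarrow> c < n \<Longrightarrow> p r c = p r k \<otimes> p k c"
    and gh: "g \<in> carrier G" "h \<in> carrier G"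
    and A: "A \<in> mirror_decomp n p (\<lambda>r c. p r c \<otimes> t) g"
    and B: "B \<in> mirror_decomp n p (\<lambda>r c. p r c \<otimes> t) h"
  shows "jordan_prod A B \<in> mirror_decomp n p (\<lambda>r c. p r c \<otimes> t) (g \<otimes> h)"
proof -
  interpret comm_group G by fact
  have U: "A \<in> UJ n" "B \<in> UJ n" using A B by (simp_all add: mirror_decomp_def)
  then have C: "A \<in> carrier_mat n n" "B \<in> carrier_mat n n" by auto
  have pk: "r \<le> k \<and> k \<le> c \<longrightarrow> p r k \<in> carrier G \<and> p k c \<in> carrier G \<and> p r c = p r k \<otimes> p k c"
    if "c < n" for r k c
    using p(1)[of r k] p(1)[of k c] p(2)[of r k c] that by fastforce
  have hg: "h \<otimes> g = g \<otimes> h" by (rule m_comm[OF gh(2,1)])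
  let ?P = "jordan_prod A B"
  have "?P \<in> UJ n"
    unfolding UJ_iff
  proof (intro conjI allI impI)
    show "?P \<in> carrier_mat n n" using C by (rule jordan_prod_carrier)
    fix r c assume rc: "c < r" "r < n"
    have "A $$ (r, k) * B $$ (k, c) + B $$ (r, k) * A $$ (k, c) = 0" if "k < n" for k
      using U rc that unfolding UJ_iff by (cases "k < r") auto
    then show "?P $$ (r, c) = 0"
      using rc by (simp add: jordan_prod_index[OF C])
  qed
  moreover have "(p r c \<noteq> g \<otimes> h \<longrightarrow> ?P $$ (r, c) + ?P $$ (n - Suc c, n - Suc r) = 0) \<and>
      (p r c \<otimes> t \<noteq> g \<otimes> h \<longrightarrow> ?P $$ (r, c) = ?P $$ (n - Suc c, n - Suc r))"
    if rc: "r \<le> c" "c < n" for r c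
  proof -
    let ?F = "\<lambda>k. A $$ (r, k) * B $$ (k, c) + B $$ (r, k) * A $$ (k, c)"
    let ?F' = "\<lambda>k. A $$ (n - Suc k, n - Suc r) * B $$ (n - Suc c, n - Suc k) +
      B $$ (n - Suc k, n - Suc r) * A $$ (n - Suc c, n - Suc k)"
    have "?P $$ (n - Suc c, n - Suc r) = (\<Sum>k<n. A $$ (n - Suc c, k) * B $$ (k, n - Suc r) +
        B $$ (n - Suc c, k) * A $$ (k, n - Suc r))"
      using rc by (simp add: jordan_prod_index[OF C])
    \<comment> \<open>Reversing the order of summation lines up the terms at the mirror position
      with those at (r, c).\<close>
    also have "\<dots> = (\<Sum>k<n. A $$ (n - Suc c, n - Suc k) * B $$ (n - Suc k, n - Suc r) +
        B $$ (n - Suc c, n - Suc k) * A $$ (n - Suc k, n - Suc r))"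
      by (rule sum.nat_diff_reindex[symmetric])
    also have "\<dots> = (\<Sum>k<n. ?F' k)" by (simp add: ac_simps)
    finally have P': "?P $$ (n - Suc c, n - Suc r) = (\<Sum>k<n. ?F' k)" .
    have P: "?P $$ (r, c) = (\<Sum>k<n. ?F k)" using rc by (simp add: jordan_prod_index[OF C])
    have "?P $$ (r, c) + ?P $$ (n - Suc c, n - Suc r) = 0" if gh: "p r c \<noteq> g \<otimes> h"
    proof -
      have "?F k + ?F' k = 0" if k: "k < n" for k
      proof -
        have "?F k + ?F' k = (A $$ (r, k) * B $$ (k, c) +
            A $$ (n - Suc k, n - Suc r) * B $$ (n - Suc c, n - Suc k)) +
            (B $$ (r, k) * A $$ (k, c) + B $$ (n - Suc k, n - Suc r) * A $$ (n - Suc c, n - Suc k))"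
          by (simp only: ac_simps)
        then show ?thesis using mirror_decomp_mult(1)[OF G two t pk[OF rc(2)] A B rc k] mirror_decomp_mult(1)[OF G two t pk[OF rc(2)] B A rc k] gh hg by simp
      qed
      then show ?thesis unfolding P P' by (simp flip: sum.distrib)
    qed
    moreover have "?P $$ (r, c) = ?P $$ (n - Suc c, n - Suc r)" if gh: "p r c \<otimes> t \<noteq> g \<otimes> h"
      unfolding P P'
    proof (rule sum.cong)
      fix k assume "k \<in> {..<n}"
      then have k: "k < n" by simp
      show "?F k = ?F' k"
        using mirror_decomp_mult(2)[OF G two t pk[OF rc(2)] A B rc k]
          mirror_decomp_mult(2)[OF G two t pk[OF rc(2)] B A rc k] gh hg by simp
    qed simp
    ultimately show ?thesis by blast
  qed
  ultimately show ?thesis unfolding mirror_decomp_def by blast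
qed

lemma Ymat_mirror_index:
  assumes "i < n" "j < n"
  shows "Ymat n x r c $$ (n - Suc j, n - Suc i) =
    (if Suc (i + c) = n \<and> Suc (j + r) = n then 1 else 0) + (if i = r \<and> j = c then x else 0)"
proof -
  have "n - Suc j = r \<and> n - Suc i = c \<longleftrightarrow> Suc (i + c) = n \<and> Suc (j + r) = n"
    "Suc (n - Suc j + c) = n \<and> Suc (n - Suc i + r) = n \<longleftrightarrow> i = r \<and> j = c"
    using assms by linarith+
  then show ?thesis using assms by (simp add: Ymat_index)
qed

lemma Ymat_UJ: "r \<le> c \<Longrightarrow> Ymat n x r c \<in> UJ n"
  by (auto simp: UJ_iff Ymat_index)

lemma Ymat_mirror_decomp:
  fixes p q :: "nat \<Rightarrow> nat \<Rightarrow> 'g"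
  assumes rc: "r \<le> c" "c < n" and p: "p (n - Suc c) (n - Suc r) = p r c"
    and q: "q (n - Suc c) (n - Suc r) = q r c"
  shows "Ymat n 1 r c \<in> (mirror_decomp n p q (p r c) :: 'k::field mat set)"
    and "Ymat n (- 1) r c \<in> (mirror_decomp n p q (q r c) :: 'k mat set)"
proof -
  have m: "p i j = p r c \<and> q i j = q r c" if "Suc (i + c) = n" "Suc (j + r) = n" for i j
  proof -
    have "i = n - Suc c" "j = n - Suc r" using that by auto
    then show ?thesis using p q by simp
  qed
  have main: "p i j \<noteq> p r c \<Longrightarrow> Ymat n 1 r c $$ (i, j) + Ymat n 1 r c $$ (n - Suc j, n - Suc i) = (0::'k)"
      "Ymat n 1 r c $$ (i, j) = (Ymat n 1 r c $$ (n - Suc j, n - Suc i) :: 'k)"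
      "Ymat n (- 1) r c $$ (i, j) + Ymat n (- 1) r c $$ (n - Suc j, n - Suc i) = (0::'k)"
      "q i j \<noteq> q r c \<Longrightarrow> Ymat n (- 1) r c $$ (i, j) = (Ymat n (- 1) r c $$ (n - Suc j, n - Suc i) :: 'k)"
    if ij: "i \<le> j" "j < n" for i j
  proof -
    define P Q where PQ: "P \<longleftrightarrow> i = r \<and> j = c" "Q \<longleftrightarrow> Suc (i + c) = n \<and> Suc (j + r) = n"
    have i: "i < n" using ij by simp
    have "P \<Longrightarrow> p i j = p r c \<and> q i j = q r c" "Q \<Longrightarrow> p i j = p r c \<and> q i j = q r c"
      unfolding PQ using m by blast+
    then show "p i j \<noteq> p r c \<Longrightarrow> Ymat n 1 r c $$ (i, j) + Ymat n 1 r c $$ (n - Suc j, n - Suc i) = (0::'k)"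
      "Ymat n 1 r c $$ (i, j) = (Ymat n 1 r c $$ (n - Suc j, n - Suc i) :: 'k)"
      "Ymat n (- 1) r c $$ (i, j) + Ymat n (- 1) r c $$ (n - Suc j, n - Suc i) = (0::'k)"
      "q i j \<noteq> q r c \<Longrightarrow> Ymat n (- 1) r c $$ (i, j) = (Ymat n (- 1) r c $$ (n - Suc j, n - Suc i) :: 'k)"
      unfolding Ymat_index[OF i ij(2)] Ymat_mirror_index[OF i ij(2)] PQ[symmetric]
      by (cases P; cases Q; simp)+
  qed
  show "Ymat n 1 r c \<in> (mirror_decomp n p q (p r c) :: 'k mat set)"
    by (rule mirror_decompI[OF Ymat_UJ[OF rc(1)]], rule main(1), assumption+, rule main(2), assumption+)
  show "Ymat n (- 1) r c \<in> (mirror_decomp n p q (q r c) :: 'k mat set)"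
    by (rule mirror_decompI[OF Ymat_UJ[OF rc(1)]], rule main(3), assumption+, rule main(4), assumption+)
qed

text \<open>The degree at (r, c) is the quotient of the partial products b c and b r of the sequence
  a, so multiplicativity is telescoping. The symmetry of a makes the product of b at c and at n - 1
  - c constant, which gives the symmetry of the quotients under the reflection.\<close>

lemma mirror_type_realization:
  fixes G (structure)
  assumes G: "comm_group G" and two: "(2::'k::field) \<noteq> 0" and n: "n \<ge> 2"
    and t: "t \<in> carrier G" "t \<otimes> t = \<one>" "t \<noteq> \<one>"
    and a: "\<And>k. Suc k < n \<Longrightarrow> a k \<in> carrier G"
      "\<And>k. Suc k < n \<Longrightarrow> a (n - Suc (Suc k)) = a k"
  obtains \<Gamma> :: "'g \<Rightarrow> 'k::field mat set" where "mirror_type G n \<Gamma>" "mirror_type.twist G n \<Gamma> = t"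
    "\<And>k. Suc k < n \<Longrightarrow> mirror_type.degp G n \<Gamma> k (Suc k) = a k"
proof -
  interpret comm_group G by fact
  define b where "b = rec_nat \<one> (\<lambda>k x. x \<otimes> a k)"
  have b0: "b 0 = \<one>" and b_Suc: "b (Suc k) = b k \<otimes> a k" for k by (simp_all add: b_def)
  have b: "b k \<in> carrier G" if "k < n" for k
    using that by (induction k) (simp_all add: b0 b_Suc a)
  have b_mirror: "b c \<otimes> b (n - Suc c) = b (n - Suc 0)" if "c < n" for c
    using that
  proof (induction c)
    case 0
    then show ?case using n b[of "n - Suc 0"] by (simp add: b0)
  next
    case (Suc c)
    define m where "m = n - Suc (Suc c)"
    have m: "n - Suc c = Suc m" "m < n" "a m = a c" using Suc.prems a(2) by (auto simp: m_def)
    have cl: "b c \<in> carrier G" "b m \<in> carrier G" "a c \<in> carrier G" using Suc.prems b a m by simp_all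
    have "b (Suc c) \<otimes> b m = b c \<otimes> b (n - Suc c)"
      using cl unfolding m(1) b_Suc m(3) by (simp add: m_ac)
    then show ?case using Suc by (simp add: m_def)
  qed
  define p where "p r c = b c \<otimes> inv (b r)" for r c
  define q where "q r c = p r c \<otimes> t" for r c
  have p_cl: "p r c \<in> carrier G" if "r \<le> c" "c < n" for r c
    using that b by (simp add: p_def)
  have p_mult: "p r c = p r k \<otimes> p k c" if "r \<le> k" "k \<le> c" "c < n" for r k c
  proof -
    have "b r \<in> carrier G" "b k \<in> carrier G" "b c \<in> carrier G" using that b by simp_all
    then show ?thesis by (simp add: p_def m_ac) (simp add: m_assoc[symmetric])
  qed
  have p_mirror: "p (n - Suc c) (n - Suc r) = p r c" if "r \<le> c" "c < n" for r c
  proof -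
    have cl: "b r \<in> carrier G" "b c \<in> carrier G" "b (n - Suc r) \<in> carrier G" "b (n - Suc c) \<in> carrier G"
      using that b by simp_all
    have "b r \<otimes> b (n - Suc r) = b c \<otimes> b (n - Suc c)" using that b_mirror by simp
    then have "b (n - Suc r) = b c \<otimes> b (n - Suc c) \<otimes> inv (b r)"
      using cl by (metis inv_solve_right' m_comm m_closed)
    then have "p (n - Suc c) (n - Suc r) = b c \<otimes> inv (b r) \<otimes> (b (n - Suc c) \<otimes> inv (b (n - Suc c)))"
      using cl unfolding p_def by (simp only: m_ac m_closed inv_closed)
    then show ?thesis using cl by (simp add: p_def)
  qed
  have q_mirror: "q (n - Suc c) (n - Suc r) = q r c" if "r \<le> c" "c < n" for r c
    using p_mirror[OF that] by (simp add: q_def)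
  define \<Gamma> :: "'g \<Rightarrow> 'k mat set" where "\<Gamma> = mirror_decomp n p q"
  have dd: "direct_decomposition G n \<Gamma>"
    unfolding \<Gamma>_def using p_cl p_mirror q_mirror t
    by (intro direct_decomposition_mirror_decomp[OF two]) (simp_all add: q_def)
  have q_fun: "q = (\<lambda>r c. p r c \<otimes> t)" by (intro ext) (simp add: q_def)
  have "grading G n \<Gamma>"
    unfolding grading_def using dd mirror_decomp_jordan_prod[OF G two t(1,2) p_cl p_mult]
    by (simp add: \<Gamma>_def q_fun)
  moreover have Y: "homogeneous G n \<Gamma> (Ymat n 1 r c) \<and> hdeg G \<Gamma> (Ymat n 1 r c) = p r c \<and>
      (Suc (r + c) \<noteq> n \<longrightarrow> homogeneous G n \<Gamma> (Ymat n (- 1) r c) \<and>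
        hdeg G \<Gamma> (Ymat n (- 1) r c) = q r c)" if "r \<le> c" "c < n" for r c
  proof -
    have Yp: "Ymat n 1 r c \<noteq> (0\<^sub>m n n :: 'k mat)" using that by (simp add: Ymat_plus_neq_zero two)
    have Ym: "Suc (r + c) \<noteq> n \<Longrightarrow> Ymat n (- 1) r c \<noteq> (0\<^sub>m n n :: 'k mat)"
      using that by (simp add: Ymat_minus_eq_zero_iff)
    have D: "Ymat n 1 r c \<in> \<Gamma> (p r c)" "Ymat n (- 1) r c \<in> \<Gamma> (q r c)"
      unfolding \<Gamma>_def using that p_mirror q_mirror by (intro Ymat_mirror_decomp; simp)+
    have cl: "p r c \<in> carrier G" "q r c \<in> carrier G" using p_cl[OF that] t by (simp_all add: q_def)
    show ?thesis
      using Yp Ym D cl hdeg_eq[OF dd cl(1) D(1) Yp] hdeg_eq[OF dd cl(2) D(2) Ym]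
      unfolding homogeneous_def by blast
  qed
  have pq: "p r c \<noteq> q r c" if "r \<le> c" "c < n" for r c
    using p_cl[OF that] t by (simp add: q_def)
  have "homogeneous G n \<Gamma> (Y_plus n i m) \<and> (Y_minus n i m \<noteq> (0\<^sub>m n n :: 'k mat) \<longrightarrow>
      homogeneous G n \<Gamma> (Y_minus n i m) \<and> hdeg G \<Gamma> (Y_plus n i m) \<noteq> hdeg G \<Gamma> (Y_minus n i m))"
    if im: "1 \<le> i" "i + m \<le> n" for i m
  proof -
    obtain r where r: "i = Suc r" using im by (cases i) auto
    have rc: "r \<le> r + m" "r + m < n" using im r by auto
    have "Y_plus n i m = (Ymat n 1 r (r + m) :: 'k mat)" "Y_minus n i m = (Ymat n (- 1) r (r + m) :: 'k mat)"
      using Y_plus_conv[OF rc] Y_minus_conv[OF rc] by (simp_all add: r)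
    then show ?thesis using Y[OF rc] pq[OF rc] rc by (simp add: Ymat_minus_eq_zero_iff)
  qed
  ultimately have "MT_grading G n \<Gamma>" unfolding MT_grading_def by blast
  then have M: "mirror_type G n \<Gamma>"
    by (intro mirror_type.intro mirror_type_axioms.intro two is_group)
  show thesis
  proof (rule that[OF M])
    have "mirror_type.twist G n \<Gamma> = q 0 0"
      using n Y[of 0 0] by (simp add: mirror_type.twist_def[OF M] mirror_type.degm_def[OF M])
    then show "mirror_type.twist G n \<Gamma> = t" using t by (simp add: q_def p_def b0)
    show "mirror_type.degp G n \<Gamma> k (Suc k) = a k" if k: "Suc k < n" for k
    proof -
      have "b k \<in> carrier G" "a k \<in> carrier G" using k a b by simp_all
      then have "p k (Suc k) = a k" unfolding p_def b_Suc by (simp add: m_comm[of "b k" "a k"] m_assoc)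
      then show ?thesis using k Y[of k "Suc k"] by (simp add: mirror_type.degp_def[OF M])
    qed
  qed
qed

section \<open>Automorphisms of the Jordan algebra\<close>

text \<open>The matrix units, counted from 0, are the matrices \<open>Ymat n 0 r c\<close>.\<close>

lemma jordan_prod_unit_index:
  fixes B :: "'k::field mat"
  assumes "B \<in> carrier_mat n n" "a < n" "b < n" "i < n" "j < n"
  shows "jordan_prod (Ymat n 0 a b) B $$ (i, j) =
    (if i = a then B $$ (b, j) else 0) + (if j = b then B $$ (i, a) else 0)"
  using jordan_prod_Ymat_index[OF assms, of 0] by simp

lemma Ymat_0_index:
  "i < n \<Longrightarrow> j < n \<Longrightarrow> Ymat n 0 r c $$ (i, j) = (if i = r \<and> j = c then 1 else 0)"
  by (simp add: Ymat_def)

lemma jordan_prod_units: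
  assumes "a < n" "b < n" "c < n" "d < n"
  shows "jordan_prod (Ymat n 0 a b) (Ymat n 0 c d) = (if b = c then Ymat n 0 a d else 0\<^sub>m n n) +
    (if d = a then Ymat n 0 c b else (0\<^sub>m n n :: 'k::field mat))"
  using assms jordan_prod_carrier[OF Ymat_carrier Ymat_carrier, of n "0::'k" a b 0 c d]
  by (intro eq_matI) (auto simp: jordan_prod_unit_index Ymat_0_index)

lemma Ymat_eq_units:
  assumes "r < n" "c < n"
  shows "Ymat n x r c = Ymat n 0 r c + x \<cdot>\<^sub>m Ymat n 0 (n - Suc c) (n - Suc r)"
proof (rule eq_matI)
  fix i j assume "i < dim_row (Ymat n 0 r c + x \<cdot>\<^sub>m Ymat n 0 (n - Suc c) (n - Suc r))"
    "j < dim_col (Ymat n 0 r c + x \<cdot>\<^sub>m Ymat n 0 (n - Suc c) (n - Suc r))"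
  then have ij: "i < n" "j < n" by simp_all
  then have iff: "(Suc (i + c) = n \<and> Suc (j + r) = n) = (i = n - Suc c \<and> j = n - Suc r)"
    using assms by linarith
  have rhs: "(Ymat n 0 r c + x \<cdot>\<^sub>m Ymat n 0 (n - Suc c) (n - Suc r)) $$ (i, j) =
      (if i = r \<and> j = c then 1 else 0) + x * (if i = n - Suc c \<and> j = n - Suc r then 1 else 0)"
    using ij by (simp add: Ymat_0_index)
  show "Ymat n x r c $$ (i, j) = (Ymat n 0 r c + x \<cdot>\<^sub>m Ymat n 0 (n - Suc c) (n - Suc r)) $$ (i, j)"
    unfolding rhs Ymat_index[OF ij] iff by simp
qed simp_all

text \<open>Reduces a claim about a whole band of matrices to the matrix units in it.\<close>

lemma subspace_UJ_contains:
  fixes A :: "'k::field mat"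
  assumes W: "subspace_UJ n W" and A: "A \<in> carrier_mat n n"
    and units: "\<And>r c. r < n \<Longrightarrow> c < n \<Longrightarrow> A $$ (r, c) \<noteq> 0 \<Longrightarrow> Ymat n 0 r c \<in> W"
  shows "A \<in> W"
proof -
  define F where "F x = A $$ x \<cdot>\<^sub>m Ymat n 0 (fst x) (snd x)" for x
  define X where "X = {x \<in> {..<n} \<times> {..<n}. A $$ x \<noteq> 0}"
  have fin: "finite X" by (simp add: X_def)
  have "mat n n (\<lambda>ij. \<Sum>x\<in>X. F x $$ ij) \<in> W"
    using W units by (intro subspace_UJ_sum[OF W fin]) (auto simp: F_def X_def subspace_UJ_def)
  moreover have "mat n n (\<lambda>ij. \<Sum>x\<in>X. F x $$ ij) = A"
  proof (rule eq_matI)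
    fix i j assume ij: "i < dim_row A" "j < dim_col A"
    then have ijn: "i < n" "j < n" using A by auto
    have "(\<Sum>x\<in>X. F x $$ (i, j)) = (\<Sum>x\<in>X. if x = (i, j) then A $$ (i, j) else 0)"
      using ijn by (intro sum.cong) (auto simp: F_def Ymat_0_index)
    also have "\<dots> = A $$ (i, j)" using fin ijn by (simp add: X_def)
    finally show "mat n n (\<lambda>ij. \<Sum>x\<in>X. F x $$ ij) $$ (i, j) = A $$ (i, j)" using ijn by simp
  qed (use A in auto)
  ultimately show ?thesis by simp
qed

text \<open>The filtration by distance from the diagonal: m = 0 gives \<open>UJ n\<close>, m = 1 the
  strictly upper triangular matrices, m = 2 the span of the products of two of these.\<close>

definition upper_band :: "nat \<Rightarrow> nat \<Rightarrow> 'k::field mat set" where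
  "upper_band n m = {A \<in> carrier_mat n n. \<forall>r<n. \<forall>c<n. A $$ (r, c) \<noteq> 0 \<longrightarrow> r + m \<le> c}"

lemma upper_bandI:
  assumes "A \<in> carrier_mat n n" "\<And>r c. r < n \<Longrightarrow> c < n \<Longrightarrow> A $$ (r, c) \<noteq> 0 \<Longrightarrow> r + m \<le> c"
  shows "A \<in> upper_band n m"
  unfolding upper_band_def by (intro CollectI conjI allI impI assms)

lemma upper_bandD: "A \<in> upper_band n m \<Longrightarrow> r < n \<Longrightarrow> c < n \<Longrightarrow> A $$ (r, c) \<noteq> 0 \<Longrightarrow> r + m \<le> c"
  by (simp add: upper_band_def)

lemma UJ_eq_upper_band: "UJ n = upper_band n 0"
proof -
  have "(\<forall>r c. c < r \<longrightarrow> r < n \<longrightarrow> A $$ (r, c) = 0) \<longleftrightarrow>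
      (\<forall>r<n. \<forall>c<n. A $$ (r, c) \<noteq> 0 \<longrightarrow> r + 0 \<le> c)" for A :: "'a::field mat"
    by (metis add_0_right less_trans not_le)
  then show ?thesis by (auto simp: UJ_iff upper_band_def)
qed

lemma upper_band_UJ:
  assumes "A \<in> upper_band n m"
  shows "A \<in> UJ n"
  unfolding UJ_eq_upper_band
proof (rule upper_bandI)
  show "A \<in> carrier_mat n n" using assms by (simp add: upper_band_def)
  show "r + 0 \<le> c" if "r < n" "c < n" "A $$ (r, c) \<noteq> 0" for r c
    using upper_bandD[OF assms that] by simp
qed

lemma subspace_upper_band: "subspace_UJ n (upper_band n m :: 'a::field mat set)"
proof -
  have "A + B \<in> upper_band n m" if AB: "A \<in> upper_band n m" "B \<in> upper_band n m" for A B :: "'a mat"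
  proof (rule upper_bandI)
    have C: "A \<in> carrier_mat n n" "B \<in> carrier_mat n n" using AB by (simp_all add: upper_band_def)
    then show "A + B \<in> carrier_mat n n" by simp
    fix r c assume rc: "r < n" "c < n" "(A + B) $$ (r, c) \<noteq> 0"
    then have "A $$ (r, c) \<noteq> 0 \<or> B $$ (r, c) \<noteq> 0" using C by auto
    then show "r + m \<le> c" using upper_bandD[OF AB(1) rc(1,2)] upper_bandD[OF AB(2) rc(1,2)] by blast
  qed
  moreover have "c \<cdot>\<^sub>m A \<in> upper_band n m" if A: "A \<in> upper_band n m" for c :: 'a and A
  proof (rule upper_bandI)
    have C: "A \<in> carrier_mat n n" using A by (simp add: upper_band_def)
    then show "c \<cdot>\<^sub>m A \<in> carrier_mat n n" by simp
    show "i + m \<le> j" if "i < n" "j < n" "(c \<cdot>\<^sub>m A) $$ (i, j) \<noteq> 0" for i j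
      using upper_bandD[OF A that(1,2)] that C by auto
  qed
  moreover have "0\<^sub>m n n \<in> (upper_band n m :: 'a mat set)" by (simp add: upper_band_def)
  ultimately show ?thesis unfolding subspace_UJ_def using upper_band_UJ by blast
qed

lemma unit_upper_band: "r < n \<Longrightarrow> c < n \<Longrightarrow> Ymat n 0 r c \<in> upper_band n m \<longleftrightarrow> r + m \<le> c"
  by (auto simp: upper_band_def Ymat_0_index)

lemma jordan_prod_upper_band:
  assumes A: "A \<in> upper_band n l" and B: "B \<in> upper_band n m"
  shows "jordan_prod A B \<in> upper_band n (l + m)"
proof -
  have C: "A \<in> carrier_mat n n" "B \<in> carrier_mat n n" using A B by (simp_all add: upper_band_def)
  have "r + (l + m) \<le> c" if rc: "r < n" "c < n" and nz: "jordan_prod A B $$ (r, c) \<noteq> 0" for r c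
  proof (rule ccontr)
    assume "\<not> ?thesis"
    have "A $$ (r, k) * B $$ (k, c) = 0 \<and> B $$ (r, k) * A $$ (k, c) = 0" if k: "k < n" for k
    proof (rule ccontr)
      assume "\<not> ?thesis"
      then consider "A $$ (r, k) \<noteq> 0" "B $$ (k, c) \<noteq> 0" | "B $$ (r, k) \<noteq> 0" "A $$ (k, c) \<noteq> 0"
        by auto
      then have "(r + l \<le> k \<and> k + m \<le> c) \<or> (r + m \<le> k \<and> k + l \<le> c)"
        using A B rc k unfolding upper_band_def by cases blast+
      then show False using \<open>\<not> r + (l + m) \<le> c\<close> by linarith
    qed
    then have "(\<Sum>k<n. A $$ (r, k) * B $$ (k, c) + B $$ (r, k) * A $$ (k, c)) = 0"
      by (intro sum.neutral ballI) (simp only: lessThan_iff, simp)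
    then show False using nz rc by (simp add: jordan_prod_index[OF C])
  qed
  then show ?thesis using jordan_prod_carrier[OF C] by (simp add: upper_band_def)
qed

lemma jordan_prod_diag:
  assumes A: "A \<in> UJ n" and B: "B \<in> UJ n" and i: "i < n"
  shows "jordan_prod A B $$ (i, i) = 2 * A $$ (i, i) * B $$ (i, i)"
proof -
  have "jordan_prod A B $$ (i, i) = (\<Sum>k<n. A $$ (i, k) * B $$ (k, i) + B $$ (i, k) * A $$ (k, i))"
    using A B i by (intro jordan_prod_index) auto
  also have "\<dots> = (\<Sum>k<n. if k = i then 2 * A $$ (i, i) * B $$ (i, i) else 0)"
  proof (rule sum.cong[OF refl])
    fix k assume "k \<in> {..<n}"
    then show "A $$ (i, k) * B $$ (k, i) + B $$ (i, k) * A $$ (k, i) =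
        (if k = i then 2 * A $$ (i, i) * B $$ (i, i) else 0)"
      using A B i by (cases k i rule: linorder_cases) (auto simp: UJ_iff)
  qed
  finally show ?thesis using i by simp
qed

text \<open>Only k = i and k = i + 1 survive in the sum: on the superdiagonal an upper triangular
  matrix acts through its diagonal alone.\<close>

lemma jordan_prod_superdiag:
  assumes A: "A \<in> UJ n" and B: "B \<in> upper_band n 1" and i: "Suc i < n"
  shows "jordan_prod A B $$ (i, Suc i) = (A $$ (i, i) + A $$ (Suc i, Suc i)) * B $$ (i, Suc i)"
proof -
  have B0: "B $$ (r, c) = 0" if "c \<le> r" "r < n" "c < n" for r c
  proof (rule ccontr)
    assume "B $$ (r, c) \<noteq> 0"
    then have "r + 1 \<le> c" using B that unfolding upper_band_def by blast
    then show False using that by simp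
  qed
  have A0: "A $$ (r, c) = 0" if "c < r" "r < n" for r c using A that by (simp add: UJ_iff)
  have "jordan_prod A B $$ (i, Suc i) =
      (\<Sum>k<n. A $$ (i, k) * B $$ (k, Suc i) + B $$ (i, k) * A $$ (k, Suc i))"
    using A upper_band_UJ[OF B] i by (intro jordan_prod_index) auto
  also have "\<dots> = (\<Sum>k<n. (if k = i then A $$ (i, i) * B $$ (i, Suc i) else 0) +
      (if k = Suc i then A $$ (Suc i, Suc i) * B $$ (i, Suc i) else 0))"
  proof (rule sum.cong[OF refl])
    fix k assume k: "k \<in> {..<n}"
    consider "k < i" | "k = i" | "k = Suc i" | "Suc i < k" by linarith
    then show "A $$ (i, k) * B $$ (k, Suc i) + B $$ (i, k) * A $$ (k, Suc i) =
        (if k = i then A $$ (i, i) * B $$ (i, Suc i) else 0) +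
        (if k = Suc i then A $$ (Suc i, Suc i) * B $$ (i, Suc i) else 0)"
      using k i by cases (simp_all add: A0 B0)
  qed
  also have "\<dots> = A $$ (i, i) * B $$ (i, Suc i) + A $$ (Suc i, Suc i) * B $$ (i, Suc i)"
    using i by (simp add: sum.distrib)
  finally show ?thesis by (simp add: distrib_right)
qed

text \<open>Injectivity forbids turning back, so the direction of the first step persists; the range
  then fixes the starting point.\<close>

lemma path_automorphism:
  fixes \<sigma> :: "nat \<Rightarrow> nat"
  assumes inj: "inj_on \<sigma> {..<n}" and range: "\<And>k. k < n \<Longrightarrow> \<sigma> k < n"
    and adj: "\<And>k. Suc k < n \<Longrightarrow> \<sigma> (Suc k) = Suc (\<sigma> k) \<or> \<sigma> k = Suc (\<sigma> (Suc k))"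
    and n: "n \<ge> 2"
  shows "(\<forall>k<n. \<sigma> k = k) \<or> (\<forall>k<n. \<sigma> k = n - Suc k)"
proof -
  have turn: "\<sigma> (Suc (Suc k)) \<noteq> \<sigma> k" if "Suc (Suc k) < n" for k
    using inj_onD[OF inj, of "Suc (Suc k)" k] that by auto
  consider "\<sigma> 1 = Suc (\<sigma> 0)" | "\<sigma> 0 = Suc (\<sigma> 1)" using adj[of 0] n by auto
  then show ?thesis
  proof cases
    case 1
    have up: "\<sigma> (Suc k) = Suc (\<sigma> k)" if "Suc k < n" for k
      using that
    proof (induction k)
      case (Suc k)
      then show ?case using adj[of "Suc k"] turn[of k] by auto
    qed (use 1 in simp)
    have "\<sigma> k = \<sigma> 0 + k" if "k < n" for k
      using that by (induction k) (simp_all add: up)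
    moreover from this[of "n - 1"] have "\<sigma> 0 = 0" using range[of "n - 1"] n by simp
    ultimately show ?thesis by simp
  next
    case 2
    have down: "\<sigma> k = Suc (\<sigma> (Suc k))" if "Suc k < n" for k
      using that
    proof (induction k)
      case (Suc k)
      then show ?case using adj[of "Suc k"] turn[of k] by auto
    qed (use 2 in simp)
    have sum: "\<sigma> k + k = \<sigma> 0" if "k < n" for k
      using that
    proof (induction k)
      case (Suc k)
      then show ?case using down[of k] by simp
    qed simp
    then have "\<sigma> 0 = n - 1" using sum[of "n - 1"] range[of 0] n by simp
    then have "\<sigma> k = n - Suc k" if "k < n" for k using sum[OF that] by simp
    then show ?thesis by blast
  qed
qed

section \<open>Diagonals and superdiagonals under an automorphism\<close>

locale jordan_automorphism =
  fixes n :: nat and \<phi> :: "'k::field mat \<Rightarrow> 'k mat"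
  assumes two: "(2::'k) \<noteq> 0"
    and bij: "bij_betw \<phi> (UJ n) (UJ n)"
    and add: "\<And>A B. A \<in> UJ n \<Longrightarrow> B \<in> UJ n \<Longrightarrow> \<phi> (A + B) = \<phi> A + \<phi> B"
    and smult: "\<And>a A. A \<in> UJ n \<Longrightarrow> \<phi> (a \<cdot>\<^sub>m A) = a \<cdot>\<^sub>m \<phi> A"
    and jordan: "\<And>A B. A \<in> UJ n \<Longrightarrow> B \<in> UJ n \<Longrightarrow> \<phi> (jordan_prod A B) = jordan_prod (\<phi> A) (\<phi> B)"
begin

lemma closed: "A \<in> UJ n \<Longrightarrow> \<phi> A \<in> UJ n"
  using bij by (auto simp: bij_betw_def)

lemma zero: "\<phi> (0\<^sub>m n n) = 0\<^sub>m n n"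
proof -
  have "\<phi> (0 \<cdot>\<^sub>m 0\<^sub>m n n) = 0 \<cdot>\<^sub>m \<phi> (0\<^sub>m n n)" using UJ_zero by (rule smult)
  moreover have "0 \<cdot>\<^sub>m A = 0\<^sub>m n n" if "A \<in> carrier_mat n n" for A :: "'k mat"
    using that by (intro eq_matI) auto
  ultimately show ?thesis using closed[OF UJ_zero] UJ_zero by auto
qed

lemma subspace_preimage:
  assumes "subspace_UJ n W"
  shows "subspace_UJ n {A \<in> UJ n. \<phi> A \<in> W}"
  using assms by (auto simp: subspace_UJ_def UJ_zero UJ_add UJ_smult zero add smult)

text \<open>Off-diagonal units have Jordan square zero, and the diagonal of a Jordan square is twice
  the square of the diagonal, so their images have zero diagonal.\<close>

lemma strictly_upper:
  assumes A: "A \<in> upper_band n 1"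
  shows "\<phi> A \<in> upper_band n 1"
proof -
  have "A \<in> {A \<in> UJ n. \<phi> A \<in> upper_band n 1}"
  proof (rule subspace_UJ_contains[OF subspace_preimage[OF subspace_upper_band]])
    fix r c assume rc: "r < n" "c < n" "A $$ (r, c) \<noteq> 0"
    then have "r + 1 \<le> c" using A unfolding upper_band_def by blast
    then have less: "r < c" by simp
    let ?E = "Ymat n 0 r c :: 'k mat"
    have E: "?E \<in> UJ n" using less by (intro Ymat_UJ) simp
    have U: "\<phi> ?E \<in> UJ n" by (rule closed[OF E])
    have "jordan_prod ?E ?E = 0\<^sub>m n n" using rc less by (simp add: jordan_prod_units)
    then have nil: "jordan_prod (\<phi> ?E) (\<phi> ?E) = 0\<^sub>m n n" using jordan[OF E E] zero by simp
    have "\<phi> ?E $$ (i, i) = 0" if "i < n" for i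
    proof -
      have "2 * \<phi> ?E $$ (i, i) * \<phi> ?E $$ (i, i) = 0"
        using jordan_prod_diag[OF U U that] nil that by simp
      then show ?thesis using two by simp
    qed
    then have "i + 1 \<le> j" if "i < n" "j < n" "\<phi> ?E $$ (i, j) \<noteq> 0" for i j
      using U that by (cases i j rule: linorder_cases) (auto simp: UJ_iff)
    then show "?E \<in> {A \<in> UJ n. \<phi> A \<in> upper_band n 1}"
      using U E by (auto simp: upper_band_def)
  qed (use A in \<open>simp add: upper_band_def\<close>)
  then show ?thesis by simp
qed

text \<open>Every unit of this band is a Jordan product of two strictly upper triangular units, to
  which \<open>strictly_upper\<close> applies.\<close>

lemma upper_band_2:
  assumes A: "A \<in> upper_band n 2"
  shows "\<phi> A \<in> upper_band n 2"
proof -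
  have "A \<in> {A \<in> UJ n. \<phi> A \<in> upper_band n 2}"
  proof (rule subspace_UJ_contains[OF subspace_preimage[OF subspace_upper_band]])
    fix r c assume rc: "r < n" "c < n" "A $$ (r, c) \<noteq> 0"
    then have "r + 2 \<le> c" using A unfolding upper_band_def by blast
    then have l: "Suc r < c" "r \<noteq> c" by simp_all
    let ?E = "Ymat n 0 r (Suc r) :: 'k mat" and ?F = "Ymat n 0 (Suc r) c :: 'k mat"
    have EF: "?E \<in> upper_band n 1" "?F \<in> upper_band n 1"
      using rc l by (simp_all add: unit_upper_band)
    have "jordan_prod ?E ?F = Ymat n 0 r c" using rc l by (auto simp: jordan_prod_units)
    then have "\<phi> (Ymat n 0 r c) = jordan_prod (\<phi> ?E) (\<phi> ?F)"
      using jordan[OF EF[THEN upper_band_UJ]] by simp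
    also have "\<dots> \<in> upper_band n (1 + 1)"
      by (intro jordan_prod_upper_band strictly_upper EF)
    finally show "Ymat n 0 r c \<in> {A \<in> UJ n. \<phi> A \<in> upper_band n 2}"
      using l by (simp add: Ymat_UJ numeral_2_eq_2)
  qed (use A in \<open>simp add: upper_band_def\<close>)
  then show ?thesis by simp
qed

text \<open>Applying the two band inclusions to the inverse as well shows that an element outside a
  band stays outside.\<close>

lemma inverse: "jordan_automorphism n (inv_into (UJ n) \<phi>)"
proof
  let ?\<psi> = "inv_into (UJ n) \<phi>"
  have im: "\<phi> ` UJ n = UJ n" and inj: "inj_on \<phi> (UJ n)" using bij by (auto simp: bij_betw_def)
  have \<psi>: "?\<psi> A \<in> UJ n \<and> \<phi> (?\<psi> A) = A" if "A \<in> UJ n" for A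
    using that im by (simp add: inv_into_into f_inv_into_f)
  have \<psi>_eqI: "?\<psi> B = A" if "A \<in> UJ n" "\<phi> A = B" for A B
    using inv_into_f_f[OF inj that(1)] that(2) by simp
  show "(2::'k) \<noteq> 0" by (rule two)
  show "bij_betw ?\<psi> (UJ n) (UJ n)" by (rule bij_betw_inv_into[OF bij])
  show "?\<psi> (A + B) = ?\<psi> A + ?\<psi> B" if "A \<in> UJ n" "B \<in> UJ n" for A B
    using \<psi> that by (intro \<psi>_eqI) (simp_all add: UJ_add add)
  show "?\<psi> (a \<cdot>\<^sub>m A) = a \<cdot>\<^sub>m ?\<psi> A" if "A \<in> UJ n" for a A
    using \<psi> that by (intro \<psi>_eqI) (simp_all add: UJ_smult smult)
  show "?\<psi> (jordan_prod A B) = jordan_prod (?\<psi> A) (?\<psi> B)" if "A \<in> UJ n" "B \<in> UJ n" for A B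
  proof (rule \<psi>_eqI)
    show "jordan_prod (?\<psi> A) (?\<psi> B) \<in> UJ n"
      using jordan_prod_upper_band[of "?\<psi> A" n 0 "?\<psi> B" 0] \<psi> that by (simp add: UJ_eq_upper_band)
    show "\<phi> (jordan_prod (?\<psi> A) (?\<psi> B)) = jordan_prod A B" using \<psi> that jordan by simp
  qed
qed

lemma upper_band_iff:
  assumes A: "A \<in> UJ n" and m: "m = 1 \<or> m = 2"
  shows "\<phi> A \<in> upper_band n m \<longleftrightarrow> A \<in> upper_band n m"
proof
  interpret inv: jordan_automorphism n "inv_into (UJ n) \<phi>" by (rule inverse)
  have "inv_into (UJ n) \<phi> (\<phi> A) = A" using A bij by (simp add: bij_betw_def)
  then show "\<phi> A \<in> upper_band n m \<Longrightarrow> A \<in> upper_band n m"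
    using m inv.strictly_upper[of "\<phi> A"] inv.upper_band_2[of "\<phi> A"] by auto
qed (use m strictly_upper upper_band_2 in auto)

lemma superdiag_nonzero:
  assumes "A \<in> upper_band n 1" "A \<notin> upper_band n 2"
  obtains j where "Suc j < n" "\<phi> A $$ (j, Suc j) \<noteq> 0"
proof -
  have B: "\<phi> A \<in> upper_band n 1" "\<phi> A \<notin> upper_band n 2"
    using assms upper_band_iff[OF upper_band_UJ[OF assms(1)]] by simp_all
  then obtain r c where rc: "r < n" "c < n" "\<phi> A $$ (r, c) \<noteq> 0" "\<not> r + 2 \<le> c"
    unfolding upper_band_def by auto
  then have "r + 1 \<le> c" using B(1) unfolding upper_band_def by blast
  then have "c = Suc r" using rc by simp
  then show thesis using that rc by simp
qed

text \<open>The diagonals of the images of the e_ii are orthogonal 0-1 vectors, none of them zero,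
  which defines the permutation \<sigma>. The superdiagonal units link neighbouring indices and
  force \<sigma> to preserve adjacency; the last clause keeps what this says about their
  images.\<close>

lemma diag_unit_image:
  assumes n: "n \<ge> 2"
  obtains \<sigma> where "(\<forall>k<n. \<sigma> k = k) \<or> (\<forall>k<n. \<sigma> k = n - Suc k)"
    "\<And>r i. r < n \<Longrightarrow> i < n \<Longrightarrow> \<phi> (Ymat n 0 r r) $$ (i, i) = (if i = \<sigma> r then 1 else 0)"
    "\<And>k j. Suc k < n \<Longrightarrow> Suc j < n \<Longrightarrow> \<phi> (Ymat n 0 k (Suc k)) $$ (j, Suc j) \<noteq> 0 \<Longrightarrow>
      j = k \<or> j = n - Suc (Suc k)"
proof -
  define f where "f r = \<phi> (Ymat n 0 r r)" for r
  have E: "Ymat n 0 r r \<in> UJ n" for r by (intro Ymat_UJ) simp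
  have f: "f r \<in> UJ n" for r by (simp add: f_def closed E)
  have f01: "f r $$ (i, i) = 0 \<or> f r $$ (i, i) = 1" if "r < n" "i < n" for r i
  proof -
    have "jordan_prod (Ymat n 0 r r) (Ymat n 0 r r) = 2 \<cdot>\<^sub>m (Ymat n 0 r r :: 'k mat)"
      using that by (auto simp: jordan_prod_units intro!: eq_matI)
    then have "\<phi> (jordan_prod (Ymat n 0 r r) (Ymat n 0 r r)) = 2 \<cdot>\<^sub>m f r"
      by (simp only: f_def smult[OF E])
    then have "jordan_prod (f r) (f r) = 2 \<cdot>\<^sub>m f r"
      by (simp only: f_def jordan[OF E E])
    then have "2 * f r $$ (i, i) * f r $$ (i, i) = 2 * f r $$ (i, i)"
      using jordan_prod_diag[OF f[of r] f[of r] that(2)] f[of r] that by (auto dest!: UJ_carrier)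
    then show ?thesis using two by auto
  qed
  have orth: "f r $$ (i, i) = 0 \<or> f s $$ (i, i) = 0" if "r < n" "s < n" "r \<noteq> s" "i < n" for r s i
  proof -
    have "jordan_prod (Ymat n 0 r r) (Ymat n 0 s s) = (0\<^sub>m n n :: 'k mat)"
      using that by (simp add: jordan_prod_units)
    then have "\<phi> (jordan_prod (Ymat n 0 r r) (Ymat n 0 s s)) = 0\<^sub>m n n"
      by (simp only: zero)
    then have "jordan_prod (f r) (f s) = 0\<^sub>m n n"
      by (simp only: f_def jordan[OF E E])
    then have "2 * f r $$ (i, i) * f s $$ (i, i) = 0"
      using jordan_prod_diag[OF f[of r] f[of s] that(4)] that by simp
    then show ?thesis using two by simp
  qed
  \<comment> \<open>The unit is not strictly upper triangular, hence neither is its image, which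
    therefore has a nonzero diagonal entry.\<close>
  have "\<exists>i<n. f r $$ (i, i) = 1" if r: "r < n" for r
  proof -
    have "f r \<notin> upper_band n 1"
      using upper_band_iff[OF E] unit_upper_band[of r n r 1] r by (simp add: f_def)
    then obtain i j where ij: "i < n" "j < n" "f r $$ (i, j) \<noteq> 0" "\<not> i + 1 \<le> j"
      using f[of r] unfolding upper_band_def by auto
    then have "i = j" using f[of r] by (cases i j rule: linorder_cases) (auto simp: UJ_iff)
    then show ?thesis using ij f01[OF r] by blast
  qed
  then obtain \<sigma> where \<sigma>: "\<And>r. r < n \<Longrightarrow> \<sigma> r < n \<and> f r $$ (\<sigma> r, \<sigma> r) = 1" by metis
  have inj: "inj_on \<sigma> {..<n}"
  proof (rule inj_onI)
    fix r s assume rs: "r \<in> {..<n}" "s \<in> {..<n}" "\<sigma> r = \<sigma> s"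
    show "r = s"
    proof (rule ccontr)
      assume "r \<noteq> s"
      then show False using orth[of r s "\<sigma> r"] \<sigma>[of r] \<sigma>[of s] rs by auto
    qed
  qed
  have surj: "\<sigma> ` {..<n} = {..<n}"
    using inj \<sigma> by (intro endo_inj_surj) auto
  have diag: "f r $$ (i, i) = (if i = \<sigma> r then 1 else 0)" if "r < n" "i < n" for r i
  proof -
    have "i \<in> \<sigma> ` {..<n}" unfolding surj using that(2) by simp
    then obtain s where s: "s < n" "i = \<sigma> s" by blast
    show ?thesis
    proof (cases "s = r")
      case False
      then have "i \<noteq> \<sigma> r" using s that inj by (auto dest: inj_onD)
      then show ?thesis using orth[OF that(1) s(1) _ that(2)] False \<sigma>[OF s(1)] s by auto
    qed (use \<sigma> s in simp)
  qed
  \<comment> \<open>The idempotents at both ends of the unit E fix it under Jordan multiplication.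
    Comparing entries at (j, j + 1) places both \<sigma> k and \<sigma> (k + 1) in {j, j +
    1}.\<close>
  have edge: "j = \<sigma> k \<and> Suc j = \<sigma> (Suc k) \<or> j = \<sigma> (Suc k) \<and> Suc j = \<sigma> k"
    if k: "Suc k < n" and j: "Suc j < n" and nz: "\<phi> (Ymat n 0 k (Suc k)) $$ (j, Suc j) \<noteq> 0" for k j
  proof -
    let ?E = "Ymat n 0 k (Suc k) :: 'k mat"
    have EB: "?E \<in> upper_band n 1" using k by (simp add: unit_upper_band)
    have "j = \<sigma> l \<or> Suc j = \<sigma> l" if l: "l = k \<or> l = Suc k" for l
    proof -
      have ln: "l < n" using l k by auto
      have "jordan_prod (Ymat n 0 l l) ?E = ?E"
        using l k ln by (auto simp: jordan_prod_units)
      then have "jordan_prod (f l) (\<phi> ?E) = \<phi> ?E"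
        using jordan[OF E upper_band_UJ[OF EB], of l] by (simp add: f_def)
      then have "(f l $$ (j, j) + f l $$ (Suc j, Suc j)) * \<phi> ?E $$ (j, Suc j) = \<phi> ?E $$ (j, Suc j)"
        using jordan_prod_superdiag[OF f[of l] strictly_upper[OF EB] j] by simp
      then have "f l $$ (j, j) + f l $$ (Suc j, Suc j) = 1" using nz by simp
      then show ?thesis using diag[OF ln] j by (auto split: if_splits)
    qed
    moreover have "\<sigma> k \<noteq> \<sigma> (Suc k)" using inj k by (auto dest: inj_onD)
    ultimately show ?thesis by metis
  qed
  have adj: "\<sigma> (Suc k) = Suc (\<sigma> k) \<or> \<sigma> k = Suc (\<sigma> (Suc k))" if k: "Suc k < n" for k
  proof -
    obtain j where "Suc j < n" "\<phi> (Ymat n 0 k (Suc k)) $$ (j, Suc j) \<noteq> 0"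
      using superdiag_nonzero[of "Ymat n 0 k (Suc k)"] k by (auto simp: unit_upper_band)
    then show ?thesis using edge[OF k] by metis
  qed
  have cases: "(\<forall>k<n. \<sigma> k = k) \<or> (\<forall>k<n. \<sigma> k = n - Suc k)"
    using \<sigma> adj by (intro path_automorphism[OF inj _ _ n]) auto
  show thesis
  proof (rule that[OF cases])
    show "\<phi> (Ymat n 0 r r) $$ (i, i) = (if i = \<sigma> r then 1 else 0)" if "r < n" "i < n" for r i
      using diag[OF that] by (simp add: f_def)
    show "j = k \<or> j = n - Suc (Suc k)"
      if "Suc k < n" "Suc j < n" "\<phi> (Ymat n 0 k (Suc k)) $$ (j, Suc j) \<noteq> 0" for k j
    proof -
      have "k < n" using that by simp
      then show ?thesis using edge[OF that] cases that(1) by auto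
    qed
  qed
qed

text \<open>The image has diagonal entries 1 and -1 at the two corners, in one order or the other.
  Its Y- coefficient at (0, 0) is thus nonzero, which is what identifies t.\<close>

lemma corner_image:
  assumes n: "n \<ge> 2"
  shows "\<phi> (Ymat n (- 1) 0 0) $$ (0, 0) \<noteq> \<phi> (Ymat n (- 1) 0 0) $$ (n - Suc 0, n - Suc 0)"
proof -
  obtain \<sigma> where \<sigma>: "(\<forall>k<n. \<sigma> k = k) \<or> (\<forall>k<n. \<sigma> k = n - Suc k)"
    and diag: "\<And>r i. r < n \<Longrightarrow> i < n \<Longrightarrow> \<phi> (Ymat n 0 r r) $$ (i, i) = (if i = \<sigma> r then 1 else 0)"
    by (rule diag_unit_image[OF n]) blast
  define m where "m = n - Suc 0"
  have m: "m < n" "m \<noteq> 0" using n by (simp_all add: m_def)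
  have E: "Ymat n 0 r r \<in> UJ n" for r by (intro Ymat_UJ) simp
  have "Ymat n (- 1) 0 0 = Ymat n 0 0 0 + (- 1) \<cdot>\<^sub>m (Ymat n 0 m m :: 'k mat)"
    using n by (subst Ymat_eq_units) (simp_all add: m_def)
  then have "\<phi> (Ymat n (- 1) 0 0) = \<phi> (Ymat n 0 0 0) + (- 1) \<cdot>\<^sub>m \<phi> (Ymat n 0 m m)"
    by (simp only: add E UJ_smult smult)
  moreover have "\<phi> (Ymat n 0 m m) \<in> carrier_mat n n" by (intro UJ_carrier closed E)
  ultimately have "\<phi> (Ymat n (- 1) 0 0) $$ (i, i) = (if i = \<sigma> 0 then 1 else 0) - (if i = \<sigma> m then 1 else 0)"
    if "i < n" for i
    using that diag[of 0 i] diag[of m i] m by auto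
  moreover have "\<sigma> 0 = 0 \<and> \<sigma> m = m \<or> \<sigma> 0 = m \<and> \<sigma> m = 0"
    using \<sigma> m n by (auto simp: m_def)
  moreover have "(1::'k) \<noteq> - 1" using two by (metis add.right_inverse one_add_one)
  ultimately show ?thesis using m unfolding m_def[symmetric] by auto
qed

text \<open>Modulo the second band Y+ is nonzero, and so is its image; each of the two units in Y+
  contributes only at its own position and the mirror image.\<close>

lemma superdiag_image:
  assumes n: "n \<ge> 2" and k: "Suc k < n"
  obtains j where "j = k \<or> j = n - Suc (Suc k)" "Suc j < n"
    "\<phi> (Ymat n 1 k (Suc k)) $$ (j, Suc j) \<noteq> 0"
proof -
  have units: "\<And>k j. Suc k < n \<Longrightarrow> Suc j < n \<Longrightarrow>
      \<phi> (Ymat n 0 k (Suc k)) $$ (j, Suc j) \<noteq> 0 \<Longrightarrow> j = k \<or> j = n - Suc (Suc k)"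
    by (rule diag_unit_image[OF n]) blast
  define m where "m = n - Suc (Suc k)"
  have m: "n - Suc k = Suc m" "Suc m < n" "n - Suc (Suc m) = k" using k by (simp_all add: m_def)
  let ?E = "Ymat n 0 k (Suc k) :: 'k mat" and ?F = "Ymat n 0 m (Suc m) :: 'k mat"
  let ?Y = "Ymat n 1 k (Suc k) :: 'k mat"
  have EF: "?E \<in> UJ n" "?F \<in> UJ n" by (intro Ymat_UJ; simp)+
  \<comment> \<open>At the centre m = k and the two units coincide; Y+ is then twice the unit, in
    agreement with the formula.\<close>
  have Y: "?Y = ?E + 1 \<cdot>\<^sub>m ?F" using k m(1) by (subst Ymat_eq_units) (simp_all add: m_def)
  have EFB: "?E \<in> upper_band n 1" "?F \<in> upper_band n 1"
    using k m by (simp_all add: unit_upper_band)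
  have "?Y \<in> upper_band n 1"
    using EFB subspace_upper_band[of n 1] unfolding Y subspace_UJ_def by blast
  moreover have "?Y \<notin> upper_band n 2"
  proof
    assume "?Y \<in> upper_band n 2"
    moreover have "?Y $$ (k, Suc k) \<noteq> 0" using k two by (simp add: Ymat_index)
    ultimately have "k + 2 \<le> Suc k" using k by (intro upper_bandD) auto
    then show False by simp
  qed
  ultimately obtain j where j: "Suc j < n" "\<phi> ?Y $$ (j, Suc j) \<noteq> 0"
    by (rule superdiag_nonzero)
  have "\<phi> ?Y = \<phi> ?E + 1 \<cdot>\<^sub>m \<phi> ?F" unfolding Y by (simp only: add EF UJ_smult smult)
  moreover have "\<phi> ?F \<in> carrier_mat n n" by (intro UJ_carrier closed EF)
  ultimately have "\<phi> ?E $$ (j, Suc j) \<noteq> 0 \<or> \<phi> ?F $$ (j, Suc j) \<noteq> 0" using j by auto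
  then have "j = k \<or> j = m" using units[OF k j(1)] units[OF m(2) j(1)] m(3) by (auto simp: m_def)
  then show thesis using that j by (simp add: m_def)
qed

end

section \<open>The classification\<close>

lemma parameters_of_graded_iso:
  fixes G (structure) and \<Gamma> \<Gamma>' :: "'g \<Rightarrow> 'k::field mat set"
  assumes A: "mirror_type G n \<Gamma>" and B: "mirror_type G n \<Gamma>'" and iso: "graded_iso G n \<Gamma> \<Gamma>'"
    and n: "n \<ge> 2"
  shows "mirror_type.twist G n \<Gamma>' = mirror_type.twist G n \<Gamma>"
    and "\<And>k. Suc k < n \<Longrightarrow>
      mirror_type.degp G n \<Gamma> k (Suc k) = mirror_type.degp G n \<Gamma>' k (Suc k) \<or>
      mirror_type.degp G n \<Gamma> k (Suc k) =
        mirror_type.degp G n \<Gamma>' k (Suc k) \<otimes> mirror_type.twist G n \<Gamma>'"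
    and "\<And>k. Suc k < n \<Longrightarrow> n - Suc (Suc k) = k \<Longrightarrow>
      mirror_type.degp G n \<Gamma> k (Suc k) = mirror_type.degp G n \<Gamma>' k (Suc k)"
proof -
  interpret A: mirror_type G n \<Gamma> by fact
  interpret B: mirror_type G n \<Gamma>' by fact
  obtain \<phi> where \<phi>: "bij_betw \<phi> (UJ n) (UJ n)"
      "\<forall>A\<in>UJ n. \<forall>B\<in>UJ n. \<phi> (A + B) = \<phi> A + \<phi> B"
      "\<forall>c. \<forall>A\<in>UJ n. \<phi> (c \<cdot>\<^sub>m A) = c \<cdot>\<^sub>m \<phi> A"
      "\<forall>A\<in>UJ n. \<forall>B\<in>UJ n. \<phi> (jordan_prod A B) = jordan_prod (\<phi> A) (\<phi> B)"
    and image: "\<forall>g\<in>carrier G. \<phi> ` \<Gamma> g = \<Gamma>' g"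
    using iso unfolding graded_iso_def by blast
  interpret jordan_automorphism n \<phi>
    by unfold_locales (use A.two \<phi> in blast)+
  have in_mirror: "\<phi> Y \<in> mirror_decomp n B.degp (\<lambda>r c. B.degp r c \<otimes> B.twist) g"
    if "g \<in> carrier G" "Y \<in> \<Gamma> g" for Y g
    using that image B.component_eq by blast
  show "B.twist = A.twist"
  proof -
    have "A.degm 0 0 = A.twist" using n A.degm_diag[of 0] by simp
    then have Y: "Ymat n (- 1) 0 0 \<in> \<Gamma> A.twist" using n A.degm(2)[of 0 0] by simp
    have tc: "A.twist \<in> carrier G" using n by simp
    \<comment> \<open>The two corner entries differ, so the degree of Y- at (0, 0) in the second
      grading is that of the given element.\<close>
    have "B.degp 0 0 \<otimes> B.twist = A.twist"
      using mirror_decompD(2)[OF in_mirror[OF tc Y] le_refl _ corner_image[OF n]] n by simp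
    then show ?thesis using n B.degp_diag[of 0] by simp
  qed
  fix k assume k: "Suc k < n"
  have ac: "A.degp k (Suc k) \<in> carrier G" "Ymat n 1 k (Suc k) \<in> \<Gamma> (A.degp k (Suc k))"
    using k A.degp[of k "Suc k"] by simp_all
  let ?X = "\<phi> (Ymat n 1 k (Suc k))"
  note X = in_mirror[OF ac]
  obtain j where j: "j = k \<or> j = n - Suc (Suc k)" "Suc j < n" "?X $$ (j, Suc j) \<noteq> 0"
    by (rule superdiag_image[OF n k])
  have pj: "B.degp j (Suc j) = B.degp k (Suc k)"
  proof -
    have "n - Suc k = Suc (n - Suc (Suc k))" using k by simp
    then show ?thesis using j(1) B.degp_mirror[of k "Suc k"] k by auto
  qed
  let ?x = "?X $$ (j, Suc j)" and ?y = "?X $$ (n - Suc (Suc j), n - Suc j)"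
  \<comment> \<open>The entry found is nonzero, so a Y+ or a Y- part is present at j; this is the
    ambiguity modulo t.\<close>
  have "?x + ?y \<noteq> 0 \<or> ?x \<noteq> ?y"
    using j(3) A.two by (metis mult_2 mult_eq_0_iff)
  then show "A.degp k (Suc k) = B.degp k (Suc k) \<or> A.degp k (Suc k) = B.degp k (Suc k) \<otimes> B.twist"
    using mirror_decompD[OF X, of j "Suc j"] j(2) pj by auto
  assume mid: "n - Suc (Suc k) = k"
  \<comment> \<open>At the centre the two mirror entries coincide, so only the Y+ part can be
    nonzero and the ambiguity disappears.\<close>
  have "j = k" using j(1) mid by simp
  then have "n - Suc (Suc j) = j" "n - Suc j = Suc j" using mid k by simp_all
  then have "?y = ?x" by simp
  then have "?x + ?y \<noteq> 0" using j(3) A.two by (metis mult_2 mult_eq_0_iff)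
  then show "A.degp k (Suc k) = B.degp k (Suc k)"
    using mirror_decompD(1)[OF X, of j "Suc j"] j(2) pj by simp
qed

section \<open>Involutions and the parameters of a grading\<close>

lemma (in group) ord_eq_2_iff:
  assumes "t \<in> carrier G"
  shows "ord t = 2 \<longleftrightarrow> t \<otimes> t = \<one> \<and> t \<noteq> \<one>"
proof -
  have "t [^] (2::nat) = t \<otimes> t" using assms by (simp add: numeral_2_eq_2)
  then have "t \<otimes> t = \<one> \<longleftrightarrow> ord t dvd 2" using pow_eq_id[OF assms, of 2] by simp
  moreover have "ord t dvd 2 \<longleftrightarrow> ord t dvd 1 \<or> ord t = 2"
  proof
    assume d: "ord t dvd 2"
    then have "0 < ord t" by (rule dvd_pos_nat[rotated]) simp
    moreover have "ord t \<le> 2" using dvd_imp_le[OF d] by simp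
    ultimately show "ord t dvd 1 \<or> ord t = 2" by auto
  qed auto
  moreover have "t = \<one> \<longleftrightarrow> ord t dvd 1" using pow_eq_id[OF assms, of 1] assms by simp
  ultimately show ?thesis by auto
qed

lemma (in comm_group) rcoset_of_involution:
  assumes t: "t \<in> carrier G" "t \<otimes> t = \<one>" and ab: "a \<in> carrier G" "b \<in> carrier G"
  shows "generate G {t} #> a = generate G {t} #> b \<longleftrightarrow> a = b \<or> a = b \<otimes> t"
proof -
  have gen: "generate G {t} = {\<one>, t}"
  proof
    have "inv t = t" using t by (intro inv_equality)
    have "x \<in> {\<one>, t}" if "x \<in> generate G {t}" for x
      using that by induction (use t \<open>inv t = t\<close> in auto)
    then show "generate G {t} \<subseteq> {\<one>, t}" by blast
    show "{\<one>, t} \<subseteq> generate G {t}" by (auto intro: generate.intros)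
  qed
  have coset: "generate G {t} #> x = {x, x \<otimes> t}" if "x \<in> carrier G" for x
    using that t by (auto simp: gen r_coset_def m_comm)
  have "b \<otimes> t \<otimes> t = b" using ab t by (simp add: m_assoc)
  then show ?thesis unfolding coset[OF ab(1)] coset[OF ab(2)] by (auto simp: doubleton_eq_iff)
qed

text \<open>By reflection only the steps before the centre count. Their number
  \<open>(n - 1) div 2\<close> is (n - 2)/2 for even n, so one definition serves both parities, with
  \<open>MT_middle\<close> added for even n.\<close>

definition MT_parameters ::
    "('g, 'b) monoid_scheme \<Rightarrow> nat \<Rightarrow> ('g \<Rightarrow> 'k::field mat set) \<Rightarrow> 'g \<times> (nat \<Rightarrow> 'g set)" where
  "MT_parameters G n \<Gamma> = (mirror_type.twist G n \<Gamma>, \<lambda>k\<in>{..<(n - 1) div 2}.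
     generate G {mirror_type.twist G n \<Gamma>} #>\<^bsub>G\<^esub> mirror_type.degp G n \<Gamma> k (Suc k))"

text \<open>Used only for even \<open>n\<close>, where it is the degree of the fixed superdiagonal position.\<close>

definition MT_middle :: "('g, 'b) monoid_scheme \<Rightarrow> nat \<Rightarrow> ('g \<Rightarrow> 'k::field mat set) \<Rightarrow> 'g" where
  "MT_middle G n \<Gamma> = mirror_type.degp G n \<Gamma> ((n - 2) div 2) (n div 2)"

lemma mirror_type_iff:
  fixes \<Gamma> :: "'g \<Rightarrow> 'k::field mat set"
  assumes "group G" "(2::'k) \<noteq> 0"
  shows "\<Gamma> \<in> MT_gradings G n \<longleftrightarrow> mirror_type G n \<Gamma>"
  using assms by (simp add: mirror_type_def mirror_type_axioms_def MT_gradings_def)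

lemma MT_parameters_eq_iff:
  fixes G (structure) and \<Gamma> \<Gamma>' :: "'g \<Rightarrow> 'k::field mat set"
  assumes G: "comm_group G" and n: "n \<ge> 2"
    and A: "mirror_type G n \<Gamma>" and B: "mirror_type G n \<Gamma>'"
  shows "graded_iso G n \<Gamma> \<Gamma>' \<longleftrightarrow> MT_parameters G n \<Gamma> = MT_parameters G n \<Gamma>' \<and>
    (even n \<longrightarrow> MT_middle G n \<Gamma> = MT_middle G n \<Gamma>')"
proof -
  interpret G: comm_group G by fact
  interpret A: mirror_type G n \<Gamma> by fact
  interpret B: mirror_type G n \<Gamma>' by fact
  have t: "A.twist \<in> carrier G" "A.twist \<otimes> A.twist = \<one>" using n A.twist_square by simp_all
  have a: "A.degp k (Suc k) \<in> carrier G" "B.degp k (Suc k) \<in> carrier G" if "Suc k < n" for k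
    using that A.degp(1) B.degp(1) by simp_all
  have small: "Suc k < n" if "k < (n - 1) div 2" for k using that by linarith
  have middle: "Suc ((n - 2) div 2) = n div 2" "Suc (n div 2) \<le> n" "n - Suc (n div 2) = (n - 2) div 2"
    if "even n" using that n by (auto elim!: evenE)
  have eq_iff: "MT_parameters G n \<Gamma> = MT_parameters G n \<Gamma>' \<longleftrightarrow> A.twist = B.twist \<and>
      (\<forall>k<(n - 1) div 2. A.degp k (Suc k) = B.degp k (Suc k) \<or>
        A.degp k (Suc k) = B.degp k (Suc k) \<otimes> A.twist)"
  proof -
    have "MT_parameters G n \<Gamma> = MT_parameters G n \<Gamma>' \<longleftrightarrow> A.twist = B.twist \<and>
        (\<forall>k<(n - 1) div 2. generate G {A.twist} #> A.degp k (Suc k) =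
          generate G {A.twist} #> B.degp k (Suc k))"
      by (auto simp: MT_parameters_def fun_eq_iff)
    also have "\<dots> \<longleftrightarrow> A.twist = B.twist \<and>
      (\<forall>k<(n - 1) div 2. A.degp k (Suc k) = B.degp k (Suc k) \<or>
        A.degp k (Suc k) = B.degp k (Suc k) \<otimes> A.twist)"
      using G.rcoset_of_involution[OF t a[OF small]] by simp
    finally show ?thesis .
  qed
  show ?thesis
  proof
    assume iso: "graded_iso G n \<Gamma> \<Gamma>'"
    note P = parameters_of_graded_iso[OF A B iso n]
    have "MT_parameters G n \<Gamma> = MT_parameters G n \<Gamma>'"
      unfolding eq_iff using P(1) P(2)[OF small] by simp
    moreover have "MT_middle G n \<Gamma> = MT_middle G n \<Gamma>'" if "even n"
      using P(3)[of "(n - 2) div 2"] middle[OF that] by (simp add: MT_middle_def)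
    ultimately show "MT_parameters G n \<Gamma> = MT_parameters G n \<Gamma>' \<and>
      (even n \<longrightarrow> MT_middle G n \<Gamma> = MT_middle G n \<Gamma>')" by blast
  next
    assume eq: "MT_parameters G n \<Gamma> = MT_parameters G n \<Gamma>' \<and>
      (even n \<longrightarrow> MT_middle G n \<Gamma> = MT_middle G n \<Gamma>')"
    then have "MT_parameters G n \<Gamma> = MT_parameters G n \<Gamma>'" by blast
    note same = this[unfolded eq_iff]
    have tw: "B.twist = A.twist" using same by simp
    show "graded_iso G n \<Gamma> \<Gamma>'"
    proof (rule graded_iso_of_same_parameters[OF G n A B tw])
      fix k assume k: "k < (n - 1) div 2"
      \<comment> \<open>The degrees of the two gradings appear in the opposite order in
        \<open>graded_iso_of_same_parameters\<close>; t t = 1 inverts the relation.\<close>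
      have "B.degp k (Suc k) \<otimes> A.twist \<otimes> A.twist = B.degp k (Suc k)"
        using a(2)[OF small[OF k]] t by (simp add: G.m_assoc)
      then show "B.degp k (Suc k) = A.degp k (Suc k) \<or>
          B.degp k (Suc k) = A.degp k (Suc k) \<otimes> A.twist"
        using same k by metis
    qed (use eq in \<open>simp add: MT_middle_def\<close>)
  qed
qed

lemma MT_parameters_range:
  fixes G (structure) and \<Gamma> :: "'g \<Rightarrow> 'k::field mat set"
  assumes G: "comm_group G" and n: "n \<ge> 2" and A: "mirror_type G n \<Gamma>"
  shows "MT_parameters G n \<Gamma> \<in> M_odd G n" and "even n \<Longrightarrow> MT_middle G n \<Gamma> \<in> carrier G"
proof -
  interpret G: comm_group G by fact
  interpret A: mirror_type G n \<Gamma> by fact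
  have "A.degp k (Suc k) \<in> carrier G" if "k < (n - 1) div 2" for k
  proof -
    have "Suc k < n" using that by linarith
    then show ?thesis using A.degp(1) by simp
  qed
  then show "MT_parameters G n \<Gamma> \<in> M_odd G n"
    using n A.twist_square A.twist_neq_one
    by (auto simp: M_odd_def MT_parameters_def G.ord_eq_2_iff FactGroup_def RCOSETS_def)
  show "MT_middle G n \<Gamma> \<in> carrier G" if "even n"
    using n A.degp(1)[of "(n - 2) div 2" "n div 2"] by (simp add: MT_middle_def div_le_mono)
qed

lemma MT_parameters_surj:
  fixes G (structure)
  assumes G: "comm_group G" and two: "(2::'k::field) \<noteq> 0" and n: "n \<ge> 2"
    and "(t, \<eta>) \<in> M_odd G n" and g: "g \<in> carrier G"
  obtains \<Gamma> :: "'g \<Rightarrow> 'k::field mat set" where "mirror_type G n \<Gamma>"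
    "MT_parameters G n \<Gamma> = (t, \<eta>)" "even n \<Longrightarrow> MT_middle G n \<Gamma> = g"
proof -
  interpret G: comm_group G by fact
  have t: "t \<in> carrier G" "t \<otimes> t = \<one>" "t \<noteq> \<one>"
    and \<eta>: "\<eta> \<in> {..<(n - 1) div 2} \<rightarrow>\<^sub>E carrier (G Mod generate G {t})"
    using assms(4) by (auto simp: M_odd_def G.ord_eq_2_iff)
  have "\<exists>x\<in>carrier G. \<eta> k = generate G {t} #> x" if "k < (n - 1) div 2" for k
  proof -
    have "\<eta> k \<in> carrier (G Mod generate G {t})" using PiE_mem[OF \<eta>] that by blast
    then show ?thesis by (auto simp: FactGroup_def RCOSETS_def)
  qed
  then obtain c where c: "\<And>k. k < (n - 1) div 2 \<Longrightarrow> c k \<in> carrier G \<and> \<eta> k = generate G {t} #> c k"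
    by metis
  \<comment> \<open>Representatives on the first half are copied to the second by reflection; within
    range the only step left is the central one for even n, which gets degree g.\<close>
  define a where "a k = (if k < (n - 1) div 2 then c k
    else if n - Suc (Suc k) < (n - 1) div 2 then c (n - Suc (Suc k)) else g)" for k
  have ac: "a k \<in> carrier G" for k using c g by (simp add: a_def)
  have a_mirror: "a (n - Suc (Suc k)) = a k" if k: "Suc k < n" for k
  proof -
    define m where "m = n - Suc (Suc k)"
    have m: "n - Suc (Suc m) = k" "k + m + 2 = n" using k by (simp_all add: m_def)
    \<comment> \<open>A step and its mirror image are never both in the first half, so the two rules
      do not conflict.\<close>
    have "\<not> (k < (n - 1) div 2 \<and> m < (n - 1) div 2)" using m(2) by linarith
    then show ?thesis unfolding a_def m_def[symmetric] m(1) by simp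
  qed
  obtain \<Gamma> :: "'g \<Rightarrow> 'k mat set" where \<Gamma>: "mirror_type G n \<Gamma>" "mirror_type.twist G n \<Gamma> = t"
      "\<And>k. Suc k < n \<Longrightarrow> mirror_type.degp G n \<Gamma> k (Suc k) = a k"
    by (rule mirror_type_realization[OF G two n t, of a], rule ac, erule a_mirror, blast)
  have "mirror_type.degp G n \<Gamma> k (Suc k) = c k" if "k < (n - 1) div 2" for k
  proof -
    have "Suc k < n" using that by linarith
    then show ?thesis using \<Gamma>(3) that by (simp add: a_def)
  qed
  then have "restrict (\<lambda>k. generate G {t} #> mirror_type.degp G n \<Gamma> k (Suc k)) {..<(n - 1) div 2} =
      restrict \<eta> {..<(n - 1) div 2}"
    using c by (intro restrict_ext) simp
  then have "MT_parameters G n \<Gamma> = (t, \<eta>)"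
    unfolding MT_parameters_def \<Gamma>(2) PiE_restrict[OF \<eta>] by simp
  moreover have "MT_middle G n \<Gamma> = g" if "even n"
  proof -
    obtain i where i: "n = 2 * i" using \<open>even n\<close> by (rule evenE)
    obtain j where "i = Suc j" using i n by (cases i) simp_all
    then have j: "n = 2 * Suc j" using i by simp
    then show ?thesis using \<Gamma>(3)[of j] by (simp add: MT_middle_def a_def)
  qed
  ultimately show thesis using that \<Gamma>(1) by blast
qed

theorem theorem18:
  fixes G :: "('g, 'b) monoid_scheme" and n :: nat
  assumes "CHAR('k::field) \<noteq> 2" and "group G" and "n \<ge> 1"
  shows "(n \<noteq> 2 \<longrightarrow>
            (\<forall>\<Gamma> :: 'g \<Rightarrow> 'k mat set. MT_grading G n \<Gamma> \<longrightarrow> commutative_support G n \<Gamma>)) \<and>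
         (comm_group G \<and> n \<ge> 2 \<longrightarrow>
            (odd n \<longrightarrow>
               (\<exists>F. bij_betw F ((MT_gradings G n :: ('g \<Rightarrow> 'k mat set) set) // MT_iso_rel G n)
                      (M_odd G n))) \<and>
            (even n \<longrightarrow>
               (\<exists>F. bij_betw F ((MT_gradings G n :: ('g \<Rightarrow> 'k mat set) set) // MT_iso_rel G n)
                      (M_even G n))))"
proof -
  have two: "(2::'k) \<noteq> 0" using assms(1) by (rule two_neq_zero_field)
  let ?X = "MT_gradings G n :: ('g \<Rightarrow> 'k mat set) set"
  have X: "\<Gamma> \<in> ?X \<longleftrightarrow> mirror_type G n \<Gamma>" for \<Gamma> by (rule mirror_type_iff[OF assms(2) two])
  have "commutative_support G n \<Gamma>" if "n \<noteq> 2" "MT_grading G n \<Gamma>" for \<Gamma> :: "'g \<Rightarrow> 'k mat set"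
    using that X[of \<Gamma>] assms(3) mirror_type.commutative_support_of_mirror_type
    by (auto simp: MT_gradings_def)
  moreover have "\<exists>F. bij_betw F (?X // MT_iso_rel G n) (M_odd G n)"
    if G: "comm_group G" and n: "n \<ge> 2" "odd n"
  proof -
    have rel: "MT_iso_rel G n = {(\<Gamma>, \<Delta>). \<Gamma> \<in> ?X \<and> \<Delta> \<in> ?X \<and> MT_parameters G n \<Gamma> = MT_parameters G n \<Delta>}"
      using n MT_parameters_eq_iff[OF G n(1)] by (auto simp: MT_iso_rel_def X)
    have "\<one>\<^bsub>G\<^esub> \<in> carrier G" using assms(2) by (simp add: group.is_monoid)
    \<comment> \<open>Odd n has no central step, so any element can be passed as middle degree; here
      it is the unit of G.\<close>
    then have "\<exists>\<Gamma>\<in>?X. MT_parameters G n \<Gamma> = x" if "x \<in> M_odd G n" for x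
      using MT_parameters_surj[OF G two n(1), of "fst x" "snd x"] that X by (metis prod.collapse)
    then show ?thesis
      unfolding rel using MT_parameters_range(1)[OF G n(1)] X by (intro bij_betw_quotient_fibres) auto
  qed
  moreover have "\<exists>F. bij_betw F (?X // MT_iso_rel G n) (M_even G n)"
    if G: "comm_group G" and n: "n \<ge> 2" "even n"
  proof -
    \<comment> \<open>The same parameters with the middle degree attached, grouped as in
      \<open>M_even\<close>.\<close>
    let ?f = "\<lambda>\<Gamma>. (fst (MT_parameters G n \<Gamma>), (snd (MT_parameters G n \<Gamma>), MT_middle G n \<Gamma>))"
    have rel: "MT_iso_rel G n = {(\<Gamma>, \<Delta>). \<Gamma> \<in> ?X \<and> \<Delta> \<in> ?X \<and> ?f \<Gamma> = ?f \<Delta>}"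
      using n MT_parameters_eq_iff[OF G n(1)] by (auto simp: MT_iso_rel_def X prod_eq_iff)
    have half: "(n - 1) div 2 = (n - 2) div 2"
    proof -
      obtain i where i: "n = 2 * i" using n(2) by (rule evenE)
      obtain j where "i = Suc j" using i n by (cases i) simp_all
      then show ?thesis using i by simp
    qed
    have M: "(t, (\<eta>, g)) \<in> M_even G n \<longleftrightarrow> (t, \<eta>) \<in> M_odd G n \<and> g \<in> carrier G" for t \<eta> g
      unfolding M_even_def M_odd_def half by simp
    have "\<exists>\<Gamma>\<in>?X. ?f \<Gamma> = x" if "x \<in> M_even G n" for x
    proof -
      obtain t \<eta> g where x: "x = (t, (\<eta>, g))" by (cases x) auto
      then have "(t, \<eta>) \<in> M_odd G n" "g \<in> carrier G" using that M by simp_all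
      then obtain \<Gamma> :: "'g \<Rightarrow> 'k mat set" where "mirror_type G n \<Gamma>" "MT_parameters G n \<Gamma> = (t, \<eta>)"
          "MT_middle G n \<Gamma> = g"
        by (rule MT_parameters_surj[OF G two n(1)]) (use n(2) in blast)
      then show ?thesis using x X n by (intro bexI[of _ \<Gamma>]) simp_all
    qed
    moreover have "?f \<Gamma> \<in> M_even G n" if "\<Gamma> \<in> ?X" for \<Gamma>
      using that MT_parameters_range[OF G n(1), of \<Gamma>] n(2) X M by simp
    ultimately show ?thesis unfolding rel by (intro bij_betw_quotient_fibres)
  qed
  ultimately show ?thesis by blast
qed

end
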